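(* Let $J$ be a strongly non-nilpotent complex structure on an $8$-dimensional nilpotent Lie algebra $\mathfrak g$ such that $\dim\mathfrak g_1=1$ and $\dim\mathfrak g_2=4$. Then the pair $(\mathfrak g,J)$ is parametrized as follows: there is a $(1,0)$-basis $\{\omega^1,\omega^2,\omega^3,\omega^4\}$ satisfying the structure equations $$\begin{aligned} d\omega^1 &= 0,\\ d\omega^2 &= A\,\omega^{1\bar 1},\\ d\omega^3 &= -D (\omega^{12}-\omega^{1\bar 2})-E\,(\omega^{14}-\omega^{1\bar 4})+F\,\omega^{1\bar 1},\\ d\omega^4 &= L\,\omega^{1\bar 1}+M\,\omega^{1\bar 2}+N\,\omega^{1\bar 3}-\bar{M}\,\omega^{2\bar 1}+i\,s\,\omega^{2\bar 2}-\bar{N}\,\omega^{3\bar 1}, \end{aligned}$$ where $A,D,E,F,L,M,N\in\mathbb C$ and $s\in\mathbb R$ satisfy the Jacobi identity (equivalently, $d^2=0$). Furthermore, in these equations: (i) if $\mathfrak g$ has ascending type $(1,4,8)$, then $(\operatorname{Re} A,\operatorname{Re} L)=(0,0)$; (ii) if $\mathfrak g$ has ascending type $(1,4,6,8)$, then $(\operatorname{Re} A,\operatorname{Re} L)\neq(0,0)$.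
   Context: Lie algebras are real and finite-dimensional. The ascending central series of $\mathfrak g$ is $\mathfrak g_0=\{0\}$, $\mathfrak g_k=\{X\in\mathfrak g \mid [X,\mathfrak g]\subseteq \mathfrak g_{k-1}\}$ for $k\geq 1$. For nilpotent $\mathfrak g$, the nilpotency step $r$ is the smallest integer $r\ge1$ with $\mathfrak g_r=\mathfrak g$, and the ascending type of $\mathfrak g$ is $(\dim\mathfrak g_1,\ldots,\dim\mathfrak g_r)$. A complex structure on $\mathfrak g$ is a linear endomorphism $J$ with $J^2=-\mathrm{Id}$ and $[X,Y]+J[JX,Y]+J[X,JY]-[JX,JY]=0$ for all $X,Y\in\mathfrak g$. Let $\mathfrak a_1(J)=\{X\in\mathfrak g \mid [X,\mathfrak g]=0 \text{ and } [JX,\mathfrak g]=0\}$. $J$ is strongly non-nilpotent (SnN) if $\mathfrak a_1(J)=\{0\}$. The differential of $e\in\mathfrak g^*$ is $de(X,Y)=-e([X,Y])$, extended complex-linearly to $\mathfrak g^*_{\mathbb C}=\mathfrak g^*\otimes\mathbb C$. A $(1,0)$-basis is a basis of the space of $(1,0)$-forms with respect to $J$; the paper's convention is that if $\{X_k,JX_k\}_{k=1}^4$ is a basis of $\mathfrak g$ with dual basis $\{x^k,y^k\}_{k=1}^4$ ($x^k$ dual to $X_k$, $y^k$ dual to $JX_k$), then the forms $x^k-i\,y^k$ are of type $(1,0)$, i.e. $(1,0)$-forms are the $\omega\in\mathfrak g^*_{\mathbb C}$ with $\omega(JX)=-i\,\omega(X)$ for all $X\in\mathfrak g$. Notation: $\omega^{jk}=\omega^j\wedge\omega^k$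 and $\omega^{j\bar k}=\omega^j\wedge\overline{\omega^k}$. *)

theory Defs
  imports "HOL-Analysis.Linear_Algebra" "HOL-Library.Function_Algebras"
begin

text \<open>The underlying vector space of the Lie algebra is a whole type of class
  \<open>real_vector\<close>; there, \<open>dim UNIV = n\<close> with \<open>n > 0\<close> entails finite-dimensionality, since
  \<open>dim\<close> of an infinite-dimensional space is \<open>0\<close>.\<close>

definition lie_algebra :: "('g::real_vector \<Rightarrow> 'g \<Rightarrow> 'g) \<Rightarrow> bool" where
  "lie_algebra br \<longleftrightarrow> bilinear br \<and> (\<forall>X. br X X = 0) \<and>
     (\<forall>X Y Z. br X (br Y Z) + br Y (br Z X) + br Z (br X Y) = 0)"

primrec ascending_central :: "('g::real_vector \<Rightarrow> 'g \<Rightarrow> 'g) \<Rightarrow> nat \<Rightarrow> 'g set" where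
  "ascending_central br 0 = {0}"
| "ascending_central br (Suc k) = {X. \<forall>Y. br X Y \<in> ascending_central br k}"

definition nilpotent_lie :: "('g::real_vector \<Rightarrow> 'g \<Rightarrow> 'g) \<Rightarrow> bool" where
  "nilpotent_lie br \<longleftrightarrow> (\<exists>r. ascending_central br r = UNIV)"

definition nilpotency_step :: "('g::real_vector \<Rightarrow> 'g \<Rightarrow> 'g) \<Rightarrow> nat" where
  "nilpotency_step br = (LEAST r. r \<ge> 1 \<and> ascending_central br r = UNIV)"

definition ascending_type :: "('g::real_vector \<Rightarrow> 'g \<Rightarrow> 'g) \<Rightarrow> nat list" where
  "ascending_type br = map (\<lambda>k. dim (ascending_central br k)) [1..<Suc (nilpotency_step br)]"

definition complex_structure ::
    "('g::real_vector \<Rightarrow> 'g \<Rightarrow> 'g) \<Rightarrow> ('g \<Rightarrow> 'g) \<Rightarrow> bool" where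
  "complex_structure br J \<longleftrightarrow> linear J \<and> (\<forall>X. J (J X) = - X) \<and>
     (\<forall>X Y. br X Y + J (br (J X) Y) + J (br X (J Y)) - br (J X) (J Y) = 0)"

definition a1 :: "('g::real_vector \<Rightarrow> 'g \<Rightarrow> 'g) \<Rightarrow> ('g \<Rightarrow> 'g) \<Rightarrow> 'g set" where
  "a1 br J = {X. (\<forall>Y. br X Y = 0) \<and> (\<forall>Y. br (J X) Y = 0)}"

definition strongly_non_nilpotent ::
    "('g::real_vector \<Rightarrow> 'g \<Rightarrow> 'g) \<Rightarrow> ('g \<Rightarrow> 'g) \<Rightarrow> bool" where
  "strongly_non_nilpotent br J \<longleftrightarrow> a1 br J = {0}"

text \<open>Elements of the complexified dual are represented as real-linear maps into \<open>complex\<close>;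
  the complex scalar action is pointwise, addition comes from \<open>Function_Algebras\<close>.\<close>

definition form_scale :: "complex \<Rightarrow> ('g \<Rightarrow> complex) \<Rightarrow> 'g \<Rightarrow> complex" where
  "form_scale c \<alpha> = (\<lambda>X. c * \<alpha> X)"

interpretation cform: vector_space "form_scale :: complex \<Rightarrow> ('g \<Rightarrow> complex) \<Rightarrow> 'g \<Rightarrow> complex"
  by unfold_locales (auto simp: form_scale_def fun_eq_iff algebra_simps)

text \<open>The sign is the one for which \<open>x - i y\<close> is of type (1,0) when \<open>x\<close> and \<open>y\<close> are dual to
  \<open>X\<close> and \<open>J X\<close>.\<close>

definition forms10 :: "('g::real_vector \<Rightarrow> 'g) \<Rightarrow> ('g \<Rightarrow> complex) set" where
  "forms10 J = {\<omega>. linear \<omega> \<and> (\<forall>X. \<omega> (J X) = - \<i> * \<omega> X)}"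

definition basis10 :: "('g::real_vector \<Rightarrow> 'g) \<Rightarrow> (nat \<Rightarrow> 'g \<Rightarrow> complex) \<Rightarrow> bool" where
  "basis10 J \<omega> \<longleftrightarrow> inj_on \<omega> {1..4} \<and> cform.independent (\<omega> ` {1..4}) \<and>
     cform.span (\<omega> ` {1..4}) = forms10 J"

definition conj_form :: "('g \<Rightarrow> complex) \<Rightarrow> 'g \<Rightarrow> complex" where
  "conj_form \<alpha> = (\<lambda>X. cnj (\<alpha> X))"

definition wedge :: "('g \<Rightarrow> complex) \<Rightarrow> ('g \<Rightarrow> complex) \<Rightarrow> 'g \<Rightarrow> 'g \<Rightarrow> complex" where
  "wedge \<alpha> \<beta> = (\<lambda>X Y. \<alpha> X * \<beta> Y - \<alpha> Y * \<beta> X)"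

text \<open>Chevalley--Eilenberg differential on 1-forms and on 2-forms.\<close>

definition d1 :: "('g \<Rightarrow> 'g \<Rightarrow> 'g) \<Rightarrow> ('g \<Rightarrow> complex) \<Rightarrow> 'g \<Rightarrow> 'g \<Rightarrow> complex" where
  "d1 br \<alpha> = (\<lambda>X Y. - \<alpha> (br X Y))"

definition d2 ::
    "('g \<Rightarrow> 'g \<Rightarrow> 'g) \<Rightarrow> ('g \<Rightarrow> 'g \<Rightarrow> complex) \<Rightarrow> 'g \<Rightarrow> 'g \<Rightarrow> 'g \<Rightarrow> complex" where
  "d2 br \<theta> = (\<lambda>X Y Z. - \<theta> (br X Y) Z + \<theta> (br X Z) Y - \<theta> (br Y Z) X)"

definition structure_equations ::
    "('g \<Rightarrow> 'g \<Rightarrow> 'g) \<Rightarrow> (nat \<Rightarrow> 'g \<Rightarrow> complex) \<Rightarrow>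
     complex \<Rightarrow> complex \<Rightarrow> complex \<Rightarrow> complex \<Rightarrow> complex \<Rightarrow> complex \<Rightarrow> complex \<Rightarrow> real \<Rightarrow> bool" where
  "structure_equations br \<omega> A D E F L M N s \<longleftrightarrow>
     (let w = (\<lambda>j k. wedge (\<omega> j) (\<omega> k)); wb = (\<lambda>j k. wedge (\<omega> j) (conj_form (\<omega> k))) in
      (\<forall>X Y.
         d1 br (\<omega> 1) X Y = 0 \<and>
         d1 br (\<omega> 2) X Y = A * wb 1 1 X Y \<and>
         d1 br (\<omega> 3) X Y = - D * (w 1 2 X Y - wb 1 2 X Y)
           - E * (w 1 4 X Y - wb 1 4 X Y) + F * wb 1 1 X Y \<and>
         d1 br (\<omega> 4) X Y = L * wb 1 1 X Y + M * wb 1 2 X Y + N * wb 1 3 X Y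
           - cnj M * wb 2 1 X Y + \<i> * of_real s * wb 2 2 X Y - cnj N * wb 3 1 X Y))"

end

theory Submission
  imports Defs
begin

text \<open>Write \<open>C k\<close> for the ascending central series and let \<open>Z\<close> span \<open>C 1\<close>. Applying the
vanishing Nijenhuis tensor to \<open>Z\<close> shows that \<open>ad (J Z)\<close> commutes with \<open>J\<close>; hence \<open>J Z
\<notin> C 2\<close>, as otherwise the image of \<open>ad (J Z)\<close> would be a \<open>J\<close>-invariant subspace of the
centre, so zero. If \<open>C 2\<close> contained no \<open>J\<close>-invariant plane, then \<open>C 2 \<oplus> J (C 2)\<close> would
be the whole algebra and all brackets would lie in \<open>C 1 + J (C 1)\<close>; nilpotency then
puts \<open>J Z\<close> into \<open>C 2\<close>, a contradiction. So there is a \<open>J\<close>-complex basis \<open>e1, e2, e3,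
e4\<close> with \<open>e4 = Z\<close> and \<open>C 2\<close> spanned over the reals by \<open>e2, e3, J e3, e4\<close>. Let \<open>w1, \<dots>,
w4\<close> be its dual (1,0)-basis and \<open>U\<close> the kernel of \<open>w1\<close>, which equals \<open>C 2 + J (C 2)\<close>.

Modulo terms in \<open>C 1 + J (C 1)\<close>, the operator \<open>ad (J y)\<close> is \<open>J\<close>-linear for each \<open>y\<close> in
\<open>C 2\<close>. Playing this against nilpotency (an \<open>ad X\<close> has no nonzero real eigenvalue on
any quotient by a \<open>C k\<close>) shows that all brackets lie in \<open>U\<close>, which is \<open>w1_br\<close>, and
that \<open>ad (J e4)\<close> kills \<open>U\<close>. The delicate point is that \<open>J e4\<close> lies in \<open>C 3\<close>. The ideal
\<open>U\<close> contains some element of \<open>C 3\<close> outside \<open>C 2\<close>; if this does not already give \<open>J e4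
\<in> C 3\<close>, then \<open>e2\<close> can be replaced so that \<open>J e2 \<in> C 3\<close>, and the Jacobi identity for
\<open>e1, J e1, J e4\<close> shows that \<open>J e4\<close> was in \<open>C 3\<close> after all. The image of \<open>ad (J e4)\<close> is
therefore the complex line of \<open>e3\<close>, which forces that line to commute with \<open>U\<close>, and
the eigenvalue argument with a second use of Jacobi, for \<open>e1, J e1, J e2\<close>, puts the
image of \<open>ad (J e2)\<close> into the span of \<open>e3, J e3, e4\<close>.

With these brackets, the differentials of the \<open>w\<close>'s minus the expected terms vanish as
soon as one argument lies in \<open>U\<close>. As \<open>U\<close> has real codimension two, such a 2-form is a
complex multiple of \<open>w1 \<and> cnj w1\<close> (\<open>alternating_factor\<close>); the multiples are the
constants \<open>A\<close>, \<open>F\<close> and \<open>L\<close>.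

For any basis satisfying the structure equations, \<open>C 2\<close> is the common kernel of \<open>\<omega> 1\<close>,
\<open>Im (\<omega> 2)\<close> and \<open>Im (\<omega> 4)\<close>: the kernel is in \<open>C 2\<close> by the equations, and both have
dimension four. On brackets the first functional is zero, and the other two are \<open>Re A\<close>
and \<open>Re L\<close> times one nonzero 2-form, so \<open>C 3\<close> is everything exactly when both real
parts vanish. This separates the two ascending types.\<close>

section \<open>Dimension counts\<close>

text \<open>A type of class \<open>real_vector\<close> carries no basis of its own, so the finite-dimensional
theory has to be interpreted with a basis obtained from the dimension hypothesis;
these are the consequences used below.\<close>

lemma finite_dim_facts:
  assumes "dim (UNIV :: 'a::real_vector set) > 0"
  shows dim_insert_notin: "\<And>x (S::'a set). x \<notin> span S \<Longrightarrow> dim (insert x S) = Suc (dim S)"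
    and subspace_eq_of_dim_le:
      "\<And>S T :: 'a set. subspace S \<Longrightarrow> subspace T \<Longrightarrow> S \<subseteq> T \<Longrightarrow> dim T \<le> dim S \<Longrightarrow> S = T"
    and dim_sum_plus_dim_Int:
      "\<And>S T :: 'a set. subspace S \<Longrightarrow> subspace T \<Longrightarrow>
         dim {x + y |x y. x \<in> S \<and> y \<in> T} + dim (S \<inter> T) = dim S + dim T"
    and dim_image_of_inj:
      "\<And>f (S::'a set). linear (f :: 'a \<Rightarrow> 'a) \<Longrightarrow> inj f \<Longrightarrow> dim (f ` S) = dim S"
    and dim_le_of_subset: "\<And>S T :: 'a set. S \<subseteq> T \<Longrightarrow> dim S \<le> dim T"
proof -
  obtain B :: "'a set" where B: "independent B" "span B = UNIV" "card B = dim (UNIV :: 'a set)"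
    by (metis basis_exists top.extremum_uniqueI)
  have fin: "finite B" using B(3) assms card.infinite by fastforce
  interpret fd: finite_dimensional_vector_space "(*\<^sub>R) :: real \<Rightarrow> 'a \<Rightarrow> 'a" B
    rewrites "module.dependent (*\<^sub>R) = dependent"
      and "module.subspace (*\<^sub>R) = subspace"
      and "module.span (*\<^sub>R) = span"
      and "vector_space.dim (*\<^sub>R) = dim"
    by unfold_locales
      (use fin B in \<open>auto simp: dependent_raw_def subspace_raw_def span_raw_def dim_raw_def\<close>)
  interpret pr: finite_dimensional_vector_space_pair_1 "(*\<^sub>R) :: real \<Rightarrow> 'a \<Rightarrow> 'a" B
      "(*\<^sub>R) :: real \<Rightarrow> 'a \<Rightarrow> 'a"
    by unfold_locales
  show "\<And>x (S::'a set). x \<notin> span S \<Longrightarrow> dim (insert x S) = Suc (dim S)"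
    by (simp add: fd.dim_insert)
  show "\<And>S T :: 'a set. subspace S \<Longrightarrow> subspace T \<Longrightarrow> S \<subseteq> T \<Longrightarrow> dim T \<le> dim S \<Longrightarrow> S = T"
    by (rule fd.subspace_dim_equal)
  show "\<And>S T :: 'a set. subspace S \<Longrightarrow> subspace T \<Longrightarrow>
         dim {x + y |x y. x \<in> S \<and> y \<in> T} + dim (S \<inter> T) = dim S + dim T"
    by (rule fd.dim_sums_Int)
  show "\<And>f (S::'a set). linear (f :: 'a \<Rightarrow> 'a) \<Longrightarrow> inj f \<Longrightarrow> dim (f ` S) = dim S"
    using pr.dim_image_eq unfolding linear_def dim_raw_def by (meson inj_on_subset subset_UNIV)
  show "\<And>S T :: 'a set. S \<subseteq> T \<Longrightarrow> dim S \<le> dim T" by (rule fd.dim_subset)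
qed

lemma dim_le_Suc_dim_kernel:
  fixes S :: "'a::real_vector set" and f :: "'a \<Rightarrow> real"
  assumes fin: "dim (UNIV :: 'a set) > 0" and S: "subspace S" and f: "linear f"
  shows "dim S \<le> Suc (dim {x \<in> S. f x = 0})"
proof (cases "\<exists>x\<in>S. f x \<noteq> 0")
  case True
  then obtain x where x: "x \<in> S" "f x \<noteq> 0" by blast
  let ?K = "{x \<in> S. f x = 0}"
  have sub: "subspace ?K" using S f
    by (auto simp: subspace_def linear_0 linear_add linear_scale)
  have "y \<in> span (insert x ?K)" if y: "y \<in> S" for y
  proof -
    have "y - (f y / f x) *\<^sub>R x \<in> ?K"
      using x y S f by (simp add: linear_diff linear_scale subspace_diff subspace_scale)
    then show ?thesis by (metis span_base span_breakdown_eq)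
  qed
  then have "dim S \<le> dim (span (insert x ?K))" by (intro dim_le_of_subset[OF fin]) auto
  also have "\<dots> = Suc (dim ?K)"
  proof -
    have "x \<notin> span ?K" unfolding span_eq_iff[THEN iffD2, OF sub] using x by simp
    then show ?thesis using dim_insert_notin[OF fin, of x ?K] by simp
  qed
  finally show ?thesis .
next
  case False
  then have "{x \<in> S. f x = 0} = S" by blast
  then show ?thesis by simp
qed

lemma dim_kernel_ge:
  fixes w1 w2 w4 :: "'g::real_vector \<Rightarrow> complex"
  assumes dim8: "dim (UNIV :: 'g set) = 8" and lin: "linear w1" "linear w2" "linear w4"
  shows "4 \<le> dim {X. w1 X = 0 \<and> Im (w2 X) = 0 \<and> Im (w4 X) = 0}"
proof -
  have fin: "dim (UNIV :: 'g set) > 0" using dim8 by simp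
  have lRe: "linear (\<lambda>X. Re (f X))" and lIm: "linear (\<lambda>X. Im (f X))"
    if "linear f" for f :: "'g \<Rightarrow> complex"
    using that by (auto simp: linear_iff)
  define S1 where "S1 = {X \<in> UNIV. Re (w1 X) = 0}"
  define S2 where "S2 = {X \<in> S1. Im (w1 X) = 0}"
  define S3 where "S3 = {X \<in> S2. Im (w2 X) = 0}"
  define S4 where "S4 = {X \<in> S3. Im (w4 X) = 0}"
  have sub: "subspace S1" "subspace S2" "subspace S3"
    using lin unfolding S1_def S2_def S3_def by (auto simp: subspace_def linear_iff linear_0)
  have "8 \<le> Suc (dim S1)"
    using dim_le_Suc_dim_kernel[OF fin subspace_UNIV lRe[OF lin(1)]] dim8 by (simp add: S1_def)
  moreover have "dim S1 \<le> Suc (dim S2)"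
    using dim_le_Suc_dim_kernel[OF fin sub(1) lIm[OF lin(1)]] by (simp add: S2_def)
  moreover have "dim S2 \<le> Suc (dim S3)"
    using dim_le_Suc_dim_kernel[OF fin sub(2) lIm[OF lin(2)]] by (simp add: S3_def)
  moreover have "dim S3 \<le> Suc (dim S4)"
    using dim_le_Suc_dim_kernel[OF fin sub(3) lIm[OF lin(3)]] by (simp add: S4_def)
  moreover have "S4 = {X. w1 X = 0 \<and> Im (w2 X) = 0 \<and> Im (w4 X) = 0}"
    by (auto simp: S1_def S2_def S3_def S4_def complex_eq_iff)
  ultimately show ?thesis by simp
qed

section \<open>Forms of type (1,0) and frames\<close>

text \<open>Multiplication by a complex scalar for the complex structure \<open>- J\<close>. The sign makes
forms of type (1,0), which satisfy \<open>\<omega> (J X) = - \<i> * \<omega> X\<close>, complex linear rather than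
antilinear.\<close>

definition cscale :: "('g::real_vector \<Rightarrow> 'g) \<Rightarrow> complex \<Rightarrow> 'g \<Rightarrow> 'g" where
  "cscale J c X = Re c *\<^sub>R X - Im c *\<^sub>R J X"

lemma forms10_linear: "\<alpha> \<in> forms10 J \<Longrightarrow> linear \<alpha>"
  and forms10_J: "\<alpha> \<in> forms10 J \<Longrightarrow> \<alpha> (J X) = - \<i> * \<alpha> X"
  by (auto simp: forms10_def)

lemma forms10_cscale:
  assumes "\<alpha> \<in> forms10 J" shows "\<alpha> (cscale J c X) = c * \<alpha> X"
  using assms
  by (simp add: cscale_def linear_diff[OF forms10_linear] linear_scale[OF forms10_linear] forms10_J)
    (simp add: complex_eq_iff)

text \<open>Every real functional is the real part of a unique form of type (1,0), so there are as
many of these forms as real functionals.\<close>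

lemma forms10_of_real_functional:
  assumes J: "linear J" "\<And>X. J (J X) = - X" and f: "linear (f :: 'g::real_vector \<Rightarrow> real)"
  shows "(\<lambda>X. Complex (f X) (f (J X))) \<in> forms10 J"
  unfolding forms10_def using J f
  by (auto simp: linear_iff complex_eq_iff linear_neg)

text \<open>A basis \<open>e\<close> of a \<open>J\<close>-invariant subspace \<open>S\<close> over the complex scalars of \<open>cscale\<close>,
together with globally defined (1,0)-forms that restrict to the dual basis. The index
set is arbitrary because frames of the whole space are built up one vector at a time,
with the vectors of the centre and of \<open>C 2\<close> first and the first basis vector last.\<close>

definition frame ::
    "('g::real_vector \<Rightarrow> 'g) \<Rightarrow> nat set \<Rightarrow> (nat \<Rightarrow> 'g) \<Rightarrow> (nat \<Rightarrow> 'g \<Rightarrow> complex) \<Rightarrow> 'g set \<Rightarrow> bool" where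
  "frame J I e \<omega> S \<longleftrightarrow> finite I \<and> subspace S \<and> J ` S \<subseteq> S \<and> dim S = 2 * card I \<and>
     (\<forall>k\<in>I. \<omega> k \<in> forms10 J \<and> e k \<in> S) \<and>
     (\<forall>j\<in>I. \<forall>k\<in>I. \<omega> j (e k) = (if j = k then 1 else 0)) \<and>
     (\<forall>X\<in>S. X = (\<Sum>k\<in>I. cscale J (\<omega> k X) (e k)))"

lemma frame_empty: "linear (J :: 'a::real_vector \<Rightarrow> 'a) \<Longrightarrow> frame J {} e \<omega> {0}"
  using dim_span[of "{} :: 'a set"] dim_eq_card_independent[OF independent_empty]
  by (simp add: frame_def linear_0)

text \<open>If \<open>J x \<equiv> t x\<close> modulo \<open>S\<close>, then \<open>- x \<equiv> t\<^sup>2 x\<close>, which is impossible for real \<open>t\<close>. This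
is why adjoining a vector to a \<open>J\<close>-invariant subspace raises the dimension by two.\<close>

lemma J_image_notin_span_insert:
  assumes J: "linear J" "\<And>X. J (J X) = - X" and S: "subspace S" "J ` S \<subseteq> S" and x: "x \<notin> S"
  shows "J x \<notin> span (insert x S)"
proof
  assume "J x \<in> span (insert x S)"
  then obtain t where s: "J x - t *\<^sub>R x \<in> S"
    using S(1) by (metis span_breakdown_eq span_eq_iff)
  then have "J (J x - t *\<^sub>R x) \<in> S" using S(2) by blast
  then have "- x - t *\<^sub>R J x \<in> S" using J by (simp add: linear_diff linear_scale)
  from subspace_add[OF S(1) this subspace_scale[OF S(1) s, of t]]
  have "- x - (t * t) *\<^sub>R x \<in> S" by (simp add: algebra_simps)
  then have "(- (1 + t * t)) *\<^sub>R x \<in> S" by (simp add: algebra_simps)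
  then have "inverse (- (1 + t * t)) *\<^sub>R ((- (1 + t * t)) *\<^sub>R x) \<in> S" by (rule subspace_scale[OF S(1)])
  moreover have "- (1 + t * t) \<noteq> 0" by (smt (verit) zero_le_square)
  ultimately show False using x by simp
qed

text \<open>The new form \<open>l\<close> is the (1,0)-form that vanishes on \<open>S\<close> and equals \<open>1\<close> at the new
vector; subtracting multiples of it from the old forms restores duality.\<close>

lemma frame_insert:
  assumes fin: "dim (UNIV :: 'g::real_vector set) > 0"
    and J: "linear J" "\<And>X :: 'g. J (J X) = - X"
    and fr: "frame J I e \<omega> S" and i: "i \<notin> I" and x: "x \<notin> S"
  obtains \<omega>' S' where "frame J (insert i I) (e(i := x)) \<omega>' S'"
proof -
  have I: "finite I" and S: "subspace S" "J ` S \<subseteq> S" and dimS: "dim S = 2 * card I"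
    and w: "\<And>k. k \<in> I \<Longrightarrow> \<omega> k \<in> forms10 J" and e: "\<And>k. k \<in> I \<Longrightarrow> e k \<in> S"
    and dual: "\<And>j k. j \<in> I \<Longrightarrow> k \<in> I \<Longrightarrow> \<omega> j (e k) = (if j = k then 1 else 0)"
    and ex: "\<And>X. X \<in> S \<Longrightarrow> X = (\<Sum>k\<in>I. cscale J (\<omega> k X) (e k))"
    using fr unfolding frame_def by blast+
  have xS: "x \<notin> span S" unfolding span_eq_iff[THEN iffD2, OF S(1)] by (rule x)
  have Jx: "J x \<notin> span (insert x S)" by (rule J_image_notin_span_insert[OF J S x])
  obtain B where B: "B \<subseteq> S" "independent B" "span B = S"
    by (metis S(1) basis_exists span_subspace)
  have spi: "span (insert x B) = span (insert x S)"
    unfolding span_insert B(3) span_eq_iff[THEN iffD2, OF S(1)] by (rule refl)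
  have ind: "independent (insert (J x) (insert x B))"
    using B x Jx spi by (simp add: independent_insertI)
  obtain f :: "'g \<Rightarrow> real" where f: "linear f"
    and fB: "\<forall>y\<in>insert (J x) (insert x B). f y = (if y = x then 1 else 0)"
    using linear_independent_extend[OF ind, of "\<lambda>y. if y = x then 1 else (0::real)"] by auto
  have fx: "f x = 1" using fB by simp
  have fJx: "f (J x) = 0" using fB Jx by (metis insertI1 span_base)
  have fS: "f y = 0" if "y \<in> S" for y
  proof (rule linear_eq_0_on_span[OF f, of B])
    fix z assume "z \<in> B"
    then show "f z = 0" using fB B x by auto
  qed (use that B in simp)
  define l where "l = (\<lambda>X. Complex (f X) (f (J X)))"
  have l: "l \<in> forms10 J" unfolding l_def by (rule forms10_of_real_functional[OF J f])
  have lx: "l x = 1" by (simp add: l_def fx fJx complex_eq_iff)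
  have lS: "l y = 0" if "y \<in> S" for y
    using that S(2) by (auto simp: l_def fS complex_eq_iff image_subset_iff)
  define w' where "w' = (\<lambda>k. if k = i then l else (\<lambda>X. \<omega> k X - \<omega> k x * l X))"
  define S' where "S' = span (insert (J x) (insert x S))"
  have w'10: "w' k \<in> forms10 J" if "k \<in> insert i I" for k
    using that w l unfolding w'_def forms10_def
    by (auto simp: linear_iff algebra_simps)
  have SS': "S \<subseteq> S'" unfolding S'_def by (meson span_superset subset_insertI subset_trans)
  have xS': "x \<in> S'" "J x \<in> S'" unfolding S'_def by (auto intro: span_base)
  have subS': "subspace S'" by (simp add: S'_def)
  have "J ` S' \<subseteq> S'"
  proof -
    have "J ` S' = span (J ` insert (J x) (insert x S))"
      unfolding S'_def by (rule linear_span_image[OF J(1), symmetric])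
    also have "\<dots> \<subseteq> S'"
      by (rule span_minimal) (use S(2) SS' xS' subS' J(2) in \<open>auto simp: subspace_neg\<close>)
    finally show ?thesis .
  qed
  moreover have "dim S' = 2 * card (insert i I)"
  proof -
    have "dim S' = Suc (Suc (dim S))"
      unfolding S'_def using dim_insert_notin[OF fin Jx] dim_insert_notin[OF fin xS] by simp
    then show ?thesis using dimS I i by simp
  qed
  moreover have "X = (\<Sum>k\<in>insert i I. cscale J (w' k X) ((e(i := x)) k))" if X: "X \<in> S'" for X
  proof -
    obtain a b where "X - a *\<^sub>R J x - b *\<^sub>R x \<in> S"
      using X unfolding S'_def span_breakdown_eq span_eq_iff[THEN iffD2, OF S(1)] by blast
    then have s0: "X - cscale J (Complex b (- a)) x \<in> S"
      by (simp add: cscale_def algebra_simps)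
    have "l (X - cscale J (Complex b (- a)) x) = l X - Complex b (- a)"
      using l lx by (simp add: linear_diff[OF forms10_linear] forms10_cscale)
    then have s: "X - cscale J (l X) x \<in> S" using s0 lS[OF s0] by simp
    have ws: "\<omega> k (X - cscale J (l X) x) = w' k X" if "k \<in> I" for k
      using that i w[OF that]
      by (auto simp: w'_def linear_diff[OF forms10_linear] forms10_cscale)
    have "X - cscale J (l X) x = (\<Sum>k\<in>I. cscale J (w' k X) (e k))"
      using ex[OF s] ws by simp
    moreover have "(\<Sum>k\<in>insert i I. cscale J (w' k X) ((e(i := x)) k))
        = cscale J (l X) x + (\<Sum>k\<in>I. cscale J (w' k X) (e k))"
    proof -
      have "(\<Sum>k\<in>I. cscale J (w' k X) ((e(i := x)) k)) = (\<Sum>k\<in>I. cscale J (w' k X) (e k))"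
        using i by (intro sum.cong) auto
      then show ?thesis using I i by (simp add: w'_def)
    qed
    ultimately show ?thesis by (simp add: algebra_simps)
  qed
  moreover have "w' j ((e(i := x)) k) = (if j = k then 1 else 0)"
    if "j \<in> insert i I" "k \<in> insert i I" for j k
    using that i dual e lS lx by (auto simp: w'_def)
  moreover have "(e(i := x)) k \<in> S'" if "k \<in> insert i I" for k
    using that xS' SS' e by auto
  ultimately have "frame J (insert i I) (e(i := x)) w' S'"
    unfolding frame_def using I subS' w'10 by blast
  then show ?thesis by (rule that)
qed

lemma cform_span_vanish:
  assumes "\<alpha> \<in> cform.span S" "\<And>\<beta>. \<beta> \<in> S \<Longrightarrow> \<beta> v = 0"
  shows "\<alpha> v = 0"
  using assms(1)
proof (induction rule: cform.span_induct_alt)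
  case base
  then show ?case by simp
next
  case (step c x y)
  then show ?case using assms(2) by (simp add: form_scale_def)
qed

text \<open>Otherwise a real functional that is \<open>1\<close> at \<open>v\<close> would give a (1,0)-form outside the span.\<close>

lemma basis10_separates:
  assumes J: "linear (J :: 'g::real_vector \<Rightarrow> 'g)" "\<And>X. J (J X) = - X" and b: "basis10 J \<omega>"
    and v: "\<And>k. k \<in> {1..4} \<Longrightarrow> \<omega> k v = 0"
  shows "v = 0"
proof (rule ccontr)
  assume "v \<noteq> 0"
  then have "independent {v}" by simp
  from linear_independent_extend[OF this, of "\<lambda>_. 1 :: real"]
  obtain f :: "'g \<Rightarrow> real" where f: "linear f" "f v = 1" by auto
  have "(\<lambda>X. Complex (f X) (f (J X))) \<in> cform.span (\<omega> ` {1..4})"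
    using forms10_of_real_functional[OF J f(1)] b by (simp add: basis10_def)
  then have "(\<lambda>X. Complex (f X) (f (J X))) v = 0"
    by (rule cform_span_vanish) (use v in auto)
  then show False using f(2) by (simp add: complex_eq_iff)
qed

lemma frame_basis10:
  assumes fr: "frame J {1..4} e \<omega> UNIV"
  shows "basis10 J \<omega>"
proof -
  have w: "\<And>k. k \<in> {1..4} \<Longrightarrow> \<omega> k \<in> forms10 J"
    and dual: "\<And>j k. j \<in> {1..4} \<Longrightarrow> k \<in> {1..4} \<Longrightarrow> \<omega> j (e k) = (if j = k then 1 else 0)"
    and ex: "\<And>X. X = (\<Sum>k\<in>{1..4}. cscale J (\<omega> k X) (e k))"
    using fr unfolding frame_def by blast+
  have inj: "inj_on \<omega> {1..4}"
    by (rule inj_onI) (metis dual zero_neq_one)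
  have ind: "cform.independent (\<omega> ` {1..4})"
  proof
    assume "cform.dependent (\<omega> ` {1..4})"
    then obtain a where a: "a \<in> \<omega> ` {1..4}" "a \<in> cform.span (\<omega> ` {1..4} - {a})"
      unfolding cform.dependent_def by blast
    then obtain j where j: "j \<in> {1..4}" "a = \<omega> j" by blast
    have "a (e j) = 0"
      by (rule cform_span_vanish[OF a(2)]) (use dual j in auto)
    then show False using dual[OF j(1) j(1)] j(2) by simp
  qed
  have "cform.subspace (forms10 J)"
    by (auto simp: cform.subspace_def forms10_def form_scale_def linear_iff algebra_simps)
  then have "cform.span (\<omega> ` {1..4}) \<subseteq> forms10 J"
    using w by (intro cform.span_minimal) auto
  moreover have "\<alpha> \<in> cform.span (\<omega> ` {1..4})" if a: "\<alpha> \<in> forms10 J" for \<alpha>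
  proof -
    have "\<alpha> = (\<Sum>k\<in>{1..4}. form_scale (\<alpha> (e k)) (\<omega> k))"
    proof
      fix X
      have "\<alpha> X = \<alpha> (\<Sum>k\<in>{1..4}. cscale J (\<omega> k X) (e k))" using ex[of X] by simp
      also have "\<dots> = (\<Sum>k\<in>{1..4}. \<alpha> (e k) * \<omega> k X)"
        by (simp add: linear_sum[OF forms10_linear[OF a]] forms10_cscale[OF a] mult.commute)
      also have "\<dots> = (\<Sum>k\<in>{1..4}. form_scale (\<alpha> (e k)) (\<omega> k)) X"
        by (induction rule: infinite_finite_induct[of _ "{1..4::nat}"]) (auto simp: form_scale_def)
      finally show "\<alpha> X = (\<Sum>k\<in>{1..4}. form_scale (\<alpha> (e k)) (\<omega> k)) X" .
    qed
    also have "\<dots> \<in> cform.span (\<omega> ` {1..4})"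
      by (intro cform.span_sum cform.span_scale cform.span_base) auto
    finally show ?thesis .
  qed
  ultimately show ?thesis unfolding basis10_def using inj ind by blast
qed

section \<open>Nilpotent Lie algebras with a complex structure\<close>

text \<open>The simplifier would otherwise rewrite membership in \<open>C 1\<close> to the defining bracket
condition, and the index \<open>1\<close> to \<open>Suc 0\<close>, and the facts about \<open>C 1\<close> would no longer
match.\<close>

declare ascending_central.simps [simp del] One_nat_def [simp del]

locale nilpotent_complex_lie_algebra =
  fixes br :: "'g::real_vector \<Rightarrow> 'g \<Rightarrow> 'g" and J :: "'g \<Rightarrow> 'g"
  assumes lie: "lie_algebra br" and nilpotent: "nilpotent_lie br" and cplx: "complex_structure br J"
begin

abbreviation "C \<equiv> ascending_central br"

lemma bilin: "bilinear br" and br_self [simp]: "br X X = 0"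
  and jacobi: "br X (br Y Z) + br Y (br Z X) + br Z (br X Y) = 0"
  using lie unfolding lie_algebra_def by blast+

lemmas br_simps =
  bilinear_ladd[OF bilin] bilinear_radd[OF bilin] bilinear_lmul[OF bilin] bilinear_rmul[OF bilin]
  bilinear_lneg[OF bilin] bilinear_rneg[OF bilin] bilinear_lsub[OF bilin] bilinear_rsub[OF bilin]
  bilinear_lzero[OF bilin] bilinear_rzero[OF bilin]

lemma br_anticomm: "br X Y = - br Y X"
proof -
  have "br (X + Y) (X + Y) = 0" by (rule br_self)
  then show ?thesis by (simp add: br_simps eq_neg_iff_add_eq_0 del: br_self) (simp add: add.commute)
qed

lemma jacobi': "br (br X Y) Z = br X (br Y Z) - br Y (br X Z)"
proof -
  have "br Z (br X Y) = - br X (br Y Z) - br Y (br Z X)"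
    using jacobi[of X Y Z] by (simp add: algebra_simps eq_neg_iff_add_eq_0)
  moreover have "br Y (br Z X) = - br Y (br X Z)"
    by (metis br_anticomm br_simps(6))
  ultimately show ?thesis using br_anticomm[of "br X Y" Z] by simp
qed

lemma J_linear: "linear J" and JJ [simp]: "J (J X) = - X"
  using cplx unfolding complex_structure_def by blast+

lemmas J_simps = linear_add[OF J_linear] linear_diff[OF J_linear] linear_scale[OF J_linear]
  linear_neg[OF J_linear] linear_0[OF J_linear]

lemma nijenhuis: "br (J X) (J Y) = br X Y + J (br (J X) Y) + J (br X (J Y))"
  using cplx unfolding complex_structure_def by (metis eq_iff_diff_eq_0)

lemma C_SucI: "(\<And>Y. br X Y \<in> C k) \<Longrightarrow> X \<in> C (Suc k)"
  and C_SucD: "X \<in> C (Suc k) \<Longrightarrow> br X Y \<in> C k"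
  by (auto simp: ascending_central.simps)

lemma C_0 [simp]: "C 0 = {0}"
  by (simp add: ascending_central.simps)

lemma C1_iff: "X \<in> C 1 \<longleftrightarrow> (\<forall>Y. br X Y = 0)"
  by (simp add: ascending_central.simps One_nat_def)

lemma C1D: "X \<in> C 1 \<Longrightarrow> br X Y = 0" "X \<in> C 1 \<Longrightarrow> br Y X = 0"
  using br_anticomm[of Y X] by (auto simp: C1_iff)

lemma C2D: "X \<in> C 2 \<Longrightarrow> br X Y \<in> C 1"
  by (metis C_SucD Suc_1)

lemma C2I: "(\<And>Y. br X Y \<in> C 1) \<Longrightarrow> X \<in> C 2"
  by (metis C_SucI Suc_1)

lemma subspace_C: "subspace (C k)"
proof (induction k)
  case (Suc k)
  then show ?case by (auto simp: subspace_def br_simps ascending_central.simps)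
qed (simp add: subspace_def)

lemma C_le_Suc: "C k \<subseteq> C (Suc k)"
proof (induction k)
  case 0
  then show ?case by (auto simp: br_simps ascending_central.simps)
next
  case (Suc k)
  then show ?case by (auto simp: ascending_central.simps)
qed

lemma C_mono: "j \<le> k \<Longrightarrow> C j \<subseteq> C k"
  using C_le_Suc by (rule lift_Suc_mono_le)

lemma C1_C2: "X \<in> C 1 \<Longrightarrow> X \<in> C 2"
  using C_mono[of 1 2] by auto

lemma C2D2: "X \<in> C 2 \<Longrightarrow> br Y X \<in> C 1"
  using C2D[of X Y] br_anticomm[of Y X] subspace_neg[OF subspace_C] by (simp add: br_simps)

lemmas C_closed = subspace_add[OF subspace_C] subspace_diff[OF subspace_C]
  subspace_scale[OF subspace_C] subspace_neg[OF subspace_C] subspace_0[OF subspace_C]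

lemma C3_I: "(\<And>Y. br X Y \<in> C 2) \<Longrightarrow> X \<in> C 3"
  and C3_D: "X \<in> C 3 \<Longrightarrow> br X Y \<in> C 2"
  and C3_D2: "X \<in> C 3 \<Longrightarrow> br Y X \<in> C 2"
proof -
  have 3: "(3::nat) = Suc 2" by simp
  show "(\<And>Y. br X Y \<in> C 2) \<Longrightarrow> X \<in> C 3" unfolding 3 by (rule C_SucI)
  show D: "br X Y \<in> C 2" if "X \<in> C 3" for X Y using that unfolding 3 by (rule C_SucD)
  show "br Y X \<in> C 2" if "X \<in> C 3"
    using C_closed(4)[OF D[OF that, of Y]] br_anticomm[of Y X] by simp
qed

text \<open>This is the Jacobi identity, evaluated by \<open>\<alpha>\<close>.\<close>

lemma d2_d1_eq_0:
  assumes "linear \<alpha>" shows "d2 br (d1 br \<alpha>) X Y Z = 0"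
proof -
  have "d2 br (d1 br \<alpha>) X Y Z = \<alpha> (br (br X Y) Z - br (br X Z) Y + br (br Y Z) X)"
    using assms by (simp add: d2_def d1_def linear_add linear_diff)
  also have "br (br X Y) Z - br (br X Z) Y + br (br Y Z) X = 0"
    using jacobi'[of X Y Z] br_anticomm[of "br X Z" Y] br_anticomm[of "br Y Z" X] by simp
  finally show ?thesis using assms by (simp add: linear_0)
qed

lemma C_UNIV: obtains r where "C r = UNIV"
  using nilpotent unfolding nilpotent_lie_def by blast

text \<open>Intersect \<open>S\<close> with the first term of the series whose intersection with \<open>S\<close> escapes \<open>C
k\<close>: its brackets lie in the previous intersection, hence in \<open>C k\<close>.\<close>

lemma ideal_meets_next_C:
  assumes S: "\<And>X Y. X \<in> S \<Longrightarrow> br X Y \<in> S" and nS: "\<not> S \<subseteq> C k"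
  obtains u where "u \<in> S" "u \<in> C (Suc k)" "u \<notin> C k"
proof -
  obtain r where r: "C r = UNIV" by (rule C_UNIV)
  let ?P = "\<lambda>j. \<not> S \<inter> C j \<subseteq> C k"
  have Pr: "?P r" using r nS by auto
  define j where "j = (LEAST j. ?P j)"
  have Pj: "?P j" unfolding j_def by (rule LeastI[of ?P, OF Pr])
  have min: "\<not> ?P i" if "i < j" for i using that unfolding j_def by (rule not_less_Least)
  have "j \<noteq> 0" using Pj C_mono[of 0 k] by auto
  then obtain i where i: "j = Suc i" by (cases j) auto
  obtain u where u: "u \<in> S" "u \<in> C j" "u \<notin> C k" using Pj by blast
  have "br u Y \<in> C k" for Y
    using min[of i] i C_SucD[of u i] u(2) S[OF u(1)] by auto
  then show ?thesis using u that C_SucI by blast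
qed

text \<open>The hypothesis says that \<open>ad X\<close> has eigenvalue \<open>- t\<close> at the class of \<open>V\<close> modulo \<open>C k\<close>.
Since \<open>ad X\<close> lowers the first index \<open>j\<close> with \<open>V \<in> C j\<close>, that eigenvalue must be zero.\<close>

lemma no_real_eigenvalue:
  assumes "t *\<^sub>R V + br X V \<in> C k" "V \<notin> C k"
  shows "t = 0"
proof -
  obtain r where r: "C r = UNIV" by (rule C_UNIV)
  define j where "j = (LEAST j. V \<in> C j)"
  have Vj: "V \<in> C j" unfolding j_def by (rule LeastI[of _ r]) (simp add: r)
  have min: "V \<notin> C i" if "i < j" for i using that unfolding j_def by (rule not_less_Least)
  have "k < j" using Vj assms(2) C_mono[of j k] by (meson in_mono not_le)
  then obtain i where i: "j = Suc i" "k \<le> i" by (cases j) auto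
  have "t *\<^sub>R V + br X V \<in> C i" using assms(1) C_mono[OF i(2)] by blast
  moreover have "br X V \<in> C i" using Vj i C_SucD[of V i X] br_anticomm[of X V] C_closed(4) by simp
  ultimately have "t *\<^sub>R V \<in> C i" using C_closed(2) by fastforce
  then have "t \<noteq> 0 \<Longrightarrow> V \<in> C i" using C_closed(3)[of "t *\<^sub>R V" i "inverse t"] by simp
  then show ?thesis using min[of i] i by blast
qed

text \<open>Take an element outside \<open>U\<close> in the first \<open>C j\<close> not contained in \<open>U\<close>.\<close>

lemma outside_with_brackets_inside:
  assumes "0 \<in> U" "U \<noteq> UNIV"
  obtains Y where "Y \<notin> U" "\<And>X. br Y X \<in> U"
proof -
  obtain r where r: "C r = UNIV" by (rule C_UNIV)
  let ?P = "\<lambda>j. \<not> C j \<subseteq> U"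
  have Pr: "?P r" using r assms(2) by auto
  define j where "j = (LEAST j. ?P j)"
  have Pj: "?P j" unfolding j_def by (rule LeastI[of ?P, OF Pr])
  have min: "\<not> ?P i" if "i < j" for i using that unfolding j_def by (rule not_less_Least)
  have "j \<noteq> 0" using Pj assms(1) by (cases j) auto
  then obtain i where i: "j = Suc i" by (cases j) auto
  then show ?thesis using Pj min[of i] that by (auto simp: ascending_central.simps)
qed

text \<open>In the Nijenhuis identity with a central first argument only the terms containing \<open>J
Z\<close> survive.\<close>

lemma br_J_C1_J:
  assumes "Z \<in> C 1" shows "br (J Z) (J Y) = J (br (J Z) Y)"
  using nijenhuis[of Z Y] by (simp add: C1D(1)[OF assms] J_simps)

text \<open>The Nijenhuis identity expresses \<open>br (J y) (J y')\<close> through brackets with an entry in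
\<open>C 2\<close>, which are central.\<close>

lemma br_complexification_C2:
  assumes "x \<in> C 2" "y \<in> C 2" "x' \<in> C 2" "y' \<in> C 2"
  shows "\<exists>a\<in>C 1. \<exists>b\<in>C 1. br (x + J y) (x' + J y') = a + J b"
proof -
  have "br (x + J y) (x' + J y') =
      (br x (x' + J y') + br (J y) x' + br y y') + J (br (J y) y' + br y (J y'))"
    by (simp add: br_simps nijenhuis J_simps)
  moreover have "br x (x' + J y') + br (J y) x' + br y y' \<in> C 1" "br (J y) y' + br y (J y') \<in> C 1"
    using assms by (auto intro!: C_closed(1) intro: C2D C2D2)
  ultimately show ?thesis by blast
qed

end

locale snn_type_1_4 = nilpotent_complex_lie_algebra br J
  for br :: "'g::real_vector \<Rightarrow> 'g \<Rightarrow> 'g" and J :: "'g \<Rightarrow> 'g" +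
  assumes dim8: "dim (UNIV :: 'g set) = 8"
    and snn: "strongly_non_nilpotent br J"
    and dimC1: "dim (ascending_central br 1) = 1"
    and dimC2: "dim (ascending_central br 2) = 4"
begin

lemma fin: "dim (UNIV :: 'g set) > 0"
  using dim8 by simp

lemma C1_multiple:
  assumes "Z \<in> C 1" "Z \<noteq> 0" "X \<in> C 1"
  obtains t where "X = t *\<^sub>R Z"
proof -
  have "span {Z} \<subseteq> C 1" using assms(1) by (intro span_minimal subspace_C) simp
  moreover have "dim (span {Z}) = 1"
    using assms(2) dim_eq_card_independent[of "{Z}"] by (simp add: dim_span)
  ultimately have "span {Z} = C 1"
    using subspace_eq_of_dim_le[OF fin, of "span {Z}" "C 1"] subspace_C dimC1 by simp
  then show ?thesis using assms(3) that by (auto simp: span_singleton)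
qed

lemma C1_nonzero: obtains Z where "Z \<in> C 1" "Z \<noteq> 0"
proof -
  have "\<not> C 1 \<subseteq> {0}"
    using dimC1 dim_le_card[of "C 1" "{}"] by auto
  then show ?thesis using that by blast
qed

text \<open>If \<open>J Z\<close> were in \<open>C 2\<close>, each bracket \<open>br (J Z) Y\<close> and its image \<open>br (J Z) (J Y)\<close> under
\<open>J\<close> would be central, hence zero by strong non-nilpotency. But then \<open>J Z\<close> itself is
central along with \<open>Z\<close>.\<close>

lemma J_C1_notin_C2:
  assumes Z: "Z \<in> C 1" and JZ: "J Z \<in> C 2"
  shows "Z = 0"
proof -
  have "br (J Z) Y = 0" for Y
  proof -
    have "br (J Z) Y \<in> C 1" "br (J Z) (J Y) \<in> C 1" using JZ C2D by blast+
    then have "br (J Z) Y \<in> a1 br J"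
      unfolding a1_def by (simp add: br_J_C1_J[OF Z] C1_iff)
    then show ?thesis using snn by (simp add: strongly_non_nilpotent_def)
  qed
  then have "Z \<in> a1 br J" using Z by (simp add: a1_def C1_iff)
  then show ?thesis using snn by (simp add: strongly_non_nilpotent_def)
qed

text \<open>The three conditions on the right are four real equations, so the kernel has dimension
at least four, the dimension of \<open>C 2\<close>; one inclusion therefore suffices.\<close>

lemma C2_eq_kernel:
  fixes w1 w2 w4 :: "'g \<Rightarrow> complex"
  assumes lin: "linear w1" "linear w2" "linear w4"
    and sub: "\<And>X. w1 X = 0 \<Longrightarrow> Im (w2 X) = 0 \<Longrightarrow> Im (w4 X) = 0 \<Longrightarrow> X \<in> C 2"
  shows "X \<in> C 2 \<longleftrightarrow> w1 X = 0 \<and> Im (w2 X) = 0 \<and> Im (w4 X) = 0"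
proof -
  let ?V = "{X. w1 X = 0 \<and> Im (w2 X) = 0 \<and> Im (w4 X) = 0}"
  have "subspace ?V" using lin by (auto simp: subspace_def linear_iff linear_0)
  moreover have "?V \<subseteq> C 2" using sub by blast
  ultimately have "?V = C 2"
    using subspace_eq_of_dim_le[OF fin, of ?V "C 2"] subspace_C dim_kernel_ge[OF dim8 lin] dimC2 by simp
  then show ?thesis by blast
qed

text \<open>If \<open>C 2\<close> met \<open>J (C 2)\<close> only in zero, their sum would have dimension eight and all
brackets would lie in \<open>C 1 + J (C 1)\<close>. That subspace would then be an ideal, so it
would contain a noncentral element of \<open>C 2\<close>, contrary to \<open>J_C1_notin_C2\<close>.\<close>

lemma C2_J_invariant_part_nonzero:
  obtains W where "W \<noteq> 0" "W \<in> C 2" "J W \<in> C 2"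
proof (rule ccontr)
  assume no: "\<not> thesis"
  have int: "C 2 \<inter> J ` C 2 \<subseteq> {0}"
  proof
    fix x assume "x \<in> C 2 \<inter> J ` C 2"
    then obtain y where y: "x \<in> C 2" "y \<in> C 2" "x = J y" by blast
    then show "x \<in> {0}" using no that[of y] by (cases "y = 0") (auto simp: J_simps)
  qed
  have injJ: "inj J" by (rule injI) (metis JJ neg_equal_iff_equal)
  have subJ: "subspace (J ` C 2)" by (rule linear_subspace_image[OF J_linear subspace_C])
  let ?U = "{x + y |x y. x \<in> C 2 \<and> y \<in> J ` C 2}"
  have "dim (C 2 \<inter> J ` C 2) = 0"
    using dim_le_card[of "C 2 \<inter> J ` C 2" "{}"] int by simp
  then have "dim ?U = 8"
    using dim_sum_plus_dim_Int[OF fin subspace_C subJ, of 2] dimC2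
      dim_image_of_inj[OF fin J_linear injJ, of "C 2"] by simp
  then have U: "?U = UNIV"
    using subspace_eq_of_dim_le[OF fin subspace_sums[OF subspace_C subJ] subspace_UNIV] dim8 by simp
  have dec: "\<exists>x\<in>C 2. \<exists>y\<in>C 2. X = x + J y" for X
  proof -
    have "X \<in> ?U" by (simp only: U UNIV_I)
    then show ?thesis by blast
  qed
  let ?K = "{x + J y |x y. x \<in> C 1 \<and> y \<in> C 1}"
  have brK: "br X Y \<in> ?K" for X Y
  proof -
    obtain x y x' y' where xy: "x \<in> C 2" "y \<in> C 2" "x' \<in> C 2" "y' \<in> C 2" "X = x + J y" "Y = x' + J y'"
      using dec[of X] dec[of Y] by blast
    show ?thesis using br_complexification_C2[OF xy(1-4)] xy(5,6) by blast
  qed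
  obtain Z where Z: "Z \<in> C 1" "Z \<noteq> 0" by (rule C1_nonzero)
  have "J Z = 0 + J Z" by simp
  then have "J Z \<in> ?K" using Z C_closed(5)[of 1] by blast
  moreover have "J Z \<notin> C 1" using J_C1_notin_C2 Z C_mono[of 1 2] by auto
  ultimately have nK: "\<not> ?K \<subseteq> C 1" by blast
  obtain u where u: "u \<in> ?K" "u \<in> C (Suc 1)" "u \<notin> C 1"
    by (rule ideal_meets_next_C[OF brK nK])
  then obtain x y where xy: "u = x + J y" "x \<in> C 1" "y \<in> C 1" by blast
  have "x \<in> C 2" using xy C_mono[of 1 2] by auto
  have "u \<in> C 2" using u(2) by (metis Suc_1)
  from C_closed(2)[OF this \<open>x \<in> C 2\<close>] have "J y \<in> C 2" unfolding xy(1) by simp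
  then have "y = 0" using J_C1_notin_C2 xy(3) by blast
  then show False using xy u(3) by (simp add: J_simps)
qed

text \<open>The vector \<open>X\<close> is prescribed because the choice of the second basis vector has to be
revised later: it must sometimes be taken so that \<open>J X\<close> lies in \<open>C 3\<close>.\<close>

lemma adapted_frame_exists:
  assumes Z: "Z \<in> C 1" "Z \<noteq> 0" and W: "W \<noteq> 0" "W \<in> C 2" "J W \<in> C 2"
    and X: "X \<in> C 2" "X \<notin> span {W, J W, Z}"
  obtains e \<omega> where "frame J {1..4} e \<omega> UNIV" "e 2 = X" "e 3 = W" "e 4 = Z"
proof -
  have f0: "frame J {} (\<lambda>_. 0) (\<lambda>_ _. 0) {0}" by (rule frame_empty[OF J_linear])
  obtain w1 S1 where f1: "frame J {3} ((\<lambda>_. 0)(3 := W)) w1 S1"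
    using frame_insert[OF fin J_linear JJ f0, of 3 W] W by auto
  have S1: "Y \<in> S1 \<Longrightarrow> Y = cscale J (w1 3 Y) W" "J ` S1 \<subseteq> S1" for Y
    using f1 unfolding frame_def by auto
  have S1_C2: "S1 \<subseteq> C 2"
  proof
    fix Y assume "Y \<in> S1"
    then show "Y \<in> C 2" using S1(1)[of Y] W C_closed by (metis cscale_def)
  qed
  have Z1: "Z \<notin> S1" using S1(2) S1_C2 J_C1_notin_C2 Z by blast
  obtain w2 S2 where f2: "frame J {4,3} ((\<lambda>_. 0)(3 := W, 4 := Z)) w2 S2"
    using frame_insert[OF fin J_linear JJ f1 _ Z1, of 4] by auto
  have S2: "Y = cscale J (w2 4 Y) Z + cscale J (w2 3 Y) W" if "Y \<in> S2" for Y
    using f2 that unfolding frame_def by auto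
  have X2: "X \<notin> S2"
  proof
    assume "X \<in> S2"
    from S2[OF this] obtain a b where Xe: "X = cscale J a Z + cscale J b W" by blast
    then have "Im a *\<^sub>R J Z = Re a *\<^sub>R Z + cscale J b W - X"
      by (simp add: cscale_def algebra_simps)
    also have "\<dots> \<in> C 2"
      using C1_C2[OF Z(1)] W X by (auto simp only: cscale_def intro!: C_closed)
    finally have "J (Im a *\<^sub>R Z) \<in> C 2" by (simp add: J_simps)
    then have "Im a *\<^sub>R Z = 0" using J_C1_notin_C2 Z(1) C_closed(3) by blast
    then have "X = Re a *\<^sub>R Z + (Re b *\<^sub>R W - Im b *\<^sub>R J W)"
      using Xe Z by (simp add: cscale_def)
    also have "\<dots> \<in> span {W, J W, Z}"
      by (intro span_add span_diff span_scale span_base) auto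
    finally show False using X by blast
  qed
  obtain w3 S3 where f3: "frame J {2,4,3} ((\<lambda>_. 0)(3 := W, 4 := Z, 2 := X)) w3 S3"
    using frame_insert[OF fin J_linear JJ f2 _ X2, of 2] by auto
  then have "dim S3 = 6" unfolding frame_def by simp
  then have "S3 \<noteq> UNIV" using dim8 by auto
  then obtain X1 where X1: "X1 \<notin> S3" by blast
  obtain w4 S4 where f4: "frame J {1,2,4,3} ((\<lambda>_. 0)(3 := W, 4 := Z, 2 := X, 1 := X1)) w4 S4"
    using frame_insert[OF fin J_linear JJ f3 _ X1, of 1] by auto
  then have "subspace S4" "dim S4 = 8" unfolding frame_def by auto
  then have "S4 = UNIV" using subspace_eq_of_dim_le[OF fin _ subspace_UNIV] dim8 by simp
  moreover have "{1,2,4,3} = {1..4::nat}" by auto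
  ultimately show ?thesis using f4 that by simp
qed

lemma C2_complement_exists:
  obtains X where "X \<in> C 2" "X \<notin> span {W, J W, Z}"
proof -
  have "dim (span {W, J W, Z}) \<le> card {W, J W, Z}" by (rule dim_le_card) auto
  also have "\<dots> \<le> 3" by (simp add: card_insert_if)
  finally have "\<not> C 2 \<subseteq> span {W, J W, Z}"
    using dim_le_of_subset[OF fin, of "C 2" "span {W, J W, Z}"] dimC2 by linarith
  then show ?thesis using that by blast
qed

end

section \<open>Brackets in an adapted frame\<close>

text \<open>In this locale the real span of \<open>e2, e3, J e3, e4\<close> is \<open>C 2\<close>, and \<open>w1 u = 0\<close> describes the
complex span \<open>U\<close> of \<open>e2, e3, e4\<close>, that is, \<open>C 2 + J (C 2)\<close>.\<close>

locale adapted_frame = snn_type_1_4 br J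
  for br :: "'g::real_vector \<Rightarrow> 'g \<Rightarrow> 'g" and J :: "'g \<Rightarrow> 'g" +
  fixes e1 e2 e3 e4 :: 'g and w1 w2 w3 w4 :: "'g \<Rightarrow> complex"
  assumes w10: "w1 \<in> forms10 J" "w2 \<in> forms10 J" "w3 \<in> forms10 J" "w4 \<in> forms10 J"
    and dual [simp]:
      "w1 e1 = 1" "w1 e2 = 0" "w1 e3 = 0" "w1 e4 = 0"
      "w2 e1 = 0" "w2 e2 = 1" "w2 e3 = 0" "w2 e4 = 0"
      "w3 e1 = 0" "w3 e2 = 0" "w3 e3 = 1" "w3 e4 = 0"
      "w4 e1 = 0" "w4 e2 = 0" "w4 e3 = 0" "w4 e4 = 1"
    and expand: "X = cscale J (w1 X) e1 + cscale J (w2 X) e2 + cscale J (w3 X) e3 + cscale J (w4 X) e4"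
    and e4_C1: "e4 \<in> C 1" and e2_C2: "e2 \<in> C 2" and e3_C2: "e3 \<in> C 2" and Je3_C2: "J e3 \<in> C 2"
begin

lemmas w_lin = w10[THEN forms10_linear]

lemmas w_simps [simp] =
  w_lin[THEN linear_add] w_lin[THEN linear_diff] w_lin[THEN linear_scale]
  w_lin[THEN linear_neg] w_lin[THEN linear_0] w10[THEN forms10_J] w10[THEN forms10_cscale]

lemma e4_nonzero: "e4 \<noteq> 0"
  using dual(16) by (metis w_simps(20) zero_neq_one)

lemma e4_C2: "e4 \<in> C 2"
  using e4_C1 C_mono[of 1 2] by auto

lemma C1_coords:
  assumes "X \<in> C 1"
  shows "w1 X = 0" "w2 X = 0" "w3 X = 0" "Im (w4 X) = 0"
proof -
  obtain t where "X = t *\<^sub>R e4" using C1_multiple[OF e4_C1 e4_nonzero assms] by blast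
  then show "w1 X = 0" "w2 X = 0" "w3 X = 0" "Im (w4 X) = 0" by simp_all
qed

lemma C1I:
  assumes "w1 X = 0" "w2 X = 0" "w3 X = 0" "Im (w4 X) = 0"
  shows "X \<in> C 1"
proof -
  have "X = Re (w4 X) *\<^sub>R e4"
    using expand[of X] assms by (simp add: cscale_def)
  then show ?thesis using C_closed(3)[OF e4_C1] by metis
qed

text \<open>The form in which membership in \<open>U\<close> is used: modulo \<open>C 2\<close>, only \<open>J e2\<close> and \<open>J e4\<close> remain.\<close>

lemma kernel_split:
  assumes "w1 u = 0"
  shows "\<exists>x\<in>C 2. u = x - Im (w2 u) *\<^sub>R J e2 - Im (w4 u) *\<^sub>R J e4"
proof -
  let ?x = "Re (w2 u) *\<^sub>R e2 + (Re (w3 u) *\<^sub>R e3 - Im (w3 u) *\<^sub>R J e3) + Re (w4 u) *\<^sub>R e4"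
  have "u = ?x - Im (w2 u) *\<^sub>R J e2 - Im (w4 u) *\<^sub>R J e4"
    using expand[of u] assms by (simp add: cscale_def algebra_simps)
  moreover have "?x \<in> C 2"
    by (intro C_closed e2_C2 e3_C2 Je3_C2 e4_C2)
  ultimately show ?thesis by blast
qed

lemma C2_iff: "X \<in> C 2 \<longleftrightarrow> w1 X = 0 \<and> Im (w2 X) = 0 \<and> Im (w4 X) = 0"
proof (rule C2_eq_kernel[OF w_lin(1,2,4)])
  fix X assume "w1 X = 0" "Im (w2 X) = 0" "Im (w4 X) = 0"
  then show "X \<in> C 2" using kernel_split[of X] by auto
qed

lemma Je4_notin_C2: "J e4 \<notin> C 2"
  by (simp add: C2_iff)

lemma br_C2_coords [simp]:
  assumes "x \<in> C 2"
  shows "w1 (br x Y) = 0" "w2 (br x Y) = 0" "w3 (br x Y) = 0" "Im (w4 (br x Y)) = 0"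
    "w1 (br Y x) = 0" "w2 (br Y x) = 0" "w3 (br Y x) = 0" "Im (w4 (br Y x)) = 0"
  using C1_coords[OF C2D[OF assms]] C1_coords[OF C2D2[OF assms]] by auto

text \<open>The correction terms in the Nijenhuis identity are \<open>br y Y + J (br y (J Y))\<close>, which lies in
\<open>C 1 + J (C 1)\<close> and is invisible to \<open>w1\<close>, \<open>w2\<close> and \<open>w3\<close>.\<close>

lemma br_J_C2_J:
  assumes "y \<in> C 2"
  shows "w1 (br (J y) (J Y)) = - \<i> * w1 (br (J y) Y)"
    "w2 (br (J y) (J Y)) = - \<i> * w2 (br (J y) Y)"
    "w3 (br (J y) (J Y)) = - \<i> * w3 (br (J y) Y)"
  using assms by (simp_all add: nijenhuis)

lemma sub_e1_kernel: "w1 (Y - cscale J (w1 Y) e1) = 0"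
  by simp

lemma decompose_e1: obtains v where "w1 v = 0" "Y = cscale J (w1 Y) e1 + v"
  by (rule that[of "Y - cscale J (w1 Y) e1"]) simp_all

text \<open>Nilpotency provides \<open>Y0\<close> outside \<open>U\<close> all of whose brackets lie in \<open>U\<close>. For \<open>y\<close> in \<open>C
2\<close> the functional \<open>Y \<mapsto> w1 (br (J y) Y)\<close> is compatible with \<open>J\<close> and vanishes at \<open>Y0\<close>
and on \<open>U\<close>, hence identically, because \<open>U\<close> and the complex line of \<open>Y0\<close> span
everything.\<close>

lemma w1_br [simp]: "w1 (br X Y) = 0"
proof -
  have "{X. w1 X = 0} \<noteq> UNIV"
    using dual(1) by (metis UNIV_I mem_Collect_eq zero_neq_one)
  then obtain Y0 where Y0: "w1 Y0 \<noteq> 0" "\<And>X. w1 (br Y0 X) = 0"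
    using outside_with_brackets_inside[of "{X. w1 X = 0}"] by auto
  have Y0': "w1 (br X Y0) = 0" for X
    using Y0(2)[of X] br_anticomm[of X Y0] by simp
  have dec: "\<exists>c v. w1 v = 0 \<and> Y = cscale J c Y0 + v" for Y
    by (rule exI[of _ "w1 Y / w1 Y0"], rule exI[of _ "Y - cscale J (w1 Y / w1 Y0) Y0"])
      (simp add: Y0(1))
  have JU: "w1 (br (J y) v) = 0" if y: "y \<in> C 2" and v: "w1 v = 0" for y v
  proof -
    obtain x where x: "x \<in> C 2" "v = x - Im (w2 v) *\<^sub>R J e2 - Im (w4 v) *\<^sub>R J e4"
      using kernel_split[OF v] by blast
    have "w1 (br (J y) (J y')) = 0" if "y' \<in> C 2" for y'
      using br_J_C2_J(1)[OF y] that by simp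
    then show ?thesis
      by (subst x(2)) (simp add: br_simps x(1) e2_C2 e4_C2)
  qed
  have JG: "w1 (br (J y) Y) = 0" if y: "y \<in> C 2" for y Y
  proof -
    obtain c v where v: "w1 v = 0" "Y = cscale J c Y0 + v" using dec by blast
    have "w1 (br (J y) (J Y0)) = 0" using br_J_C2_J(1)[OF y] Y0' by simp
    then show ?thesis
      by (subst v(2)) (simp add: br_simps cscale_def Y0' JU[OF y v(1)])
  qed
  have UG: "w1 (br u Y) = 0" if u: "w1 u = 0" for u Y
  proof -
    obtain x where x: "x \<in> C 2" "u = x - Im (w2 u) *\<^sub>R J e2 - Im (w4 u) *\<^sub>R J e4"
      using kernel_split[OF u] by blast
    show ?thesis
      by (subst x(2)) (simp add: br_simps x(1) JG e2_C2 e4_C2)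
  qed
  have GU: "w1 (br Y u) = 0" if u: "w1 u = 0" for u Y
    using UG[OF u, of Y] br_anticomm[of Y u] by simp
  obtain c u where u: "w1 u = 0" "X = cscale J c Y0 + u" using dec by blast
  obtain d v where v: "w1 v = 0" "Y = cscale J d Y0 + v" using dec by blast
  show ?thesis
    by (subst u(2), subst v(2)) (simp add: br_simps cscale_def Y0(2) Y0' UG[OF u(1)] GU[OF v(1)])
qed

lemma br_Je4_J: "br (J e4) (J Y) = J (br (J e4) Y)"
  by (rule br_J_C1_J[OF e4_C1])

text \<open>The bracket is a multiple \<open>t e4\<close> of the central vector. By \<open>br_J_C1_J\<close>, \<open>br (J x) (J
e4) = - t (J e4)\<close>, so \<open>t\<close> is an eigenvalue up to sign and must vanish.\<close>

lemma br_Je4_C2: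
  assumes x: "x \<in> C 2" shows "br (J e4) x = 0"
proof -
  obtain t where t: "br (J e4) x = t *\<^sub>R e4"
    using C1_multiple[OF e4_C1 e4_nonzero C2D2[OF x]] by blast
  have "br (J x) (J e4) = - t *\<^sub>R J e4"
    using br_anticomm[of "J x" "J e4"] br_Je4_J[of x] t by (simp add: J_simps)
  then have "t *\<^sub>R J e4 + br (J x) (J e4) \<in> C 2" using C_closed(5) by simp
  then have "t = 0" using no_real_eigenvalue Je4_notin_C2 by blast
  then show ?thesis using t by simp
qed

lemma br_Je4_kernel:
  assumes u: "w1 u = 0" shows "br (J e4) u = 0" "br u (J e4) = 0"
proof -
  obtain x where x: "x \<in> C 2" "u = x - Im (w2 u) *\<^sub>R J e2 - Im (w4 u) *\<^sub>R J e4"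
    using kernel_split[OF u] by blast
  show "br (J e4) u = 0"
    by (subst x(2)) (simp add: br_simps br_Je4_C2 x(1) br_Je4_J e2_C2 J_simps)
  then show "br u (J e4) = 0" using br_anticomm[of u] by simp
qed

lemma br_Je2_kernel:
  assumes u: "w1 u = 0" shows "br (J e2) u \<in> C 1"
proof -
  obtain x where x: "x \<in> C 2" "u = x - Im (w2 u) *\<^sub>R J e2 - Im (w4 u) *\<^sub>R J e4"
    using kernel_split[OF u] by blast
  have "br (J e2) u = br (J e2) x"
    by (subst x(2)) (simp add: br_simps br_Je4_kernel)
  then show ?thesis using C2D2[OF x(1)] by simp
qed

lemma br_kernel_kernel:
  assumes u: "w1 u = 0" and v: "w1 v = 0" shows "br u v \<in> C 1"
proof -
  obtain x where x: "x \<in> C 2" "u = x - Im (w2 u) *\<^sub>R J e2 - Im (w4 u) *\<^sub>R J e4"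
    using kernel_split[OF u] by blast
  have "br u v = br x v - Im (w2 u) *\<^sub>R br (J e2) v"
    by (subst x(2)) (simp add: br_simps br_Je4_kernel[OF v])
  then show ?thesis using C2D[OF x(1)] br_Je2_kernel[OF v] by (metis C_closed(2,3))
qed

lemma br_Je4: "br (J e4) Y = cscale J (w1 Y) (br (J e4) e1)"
proof -
  obtain v where v: "w1 v = 0" "Y = cscale J (w1 Y) e1 + v" by (rule decompose_e1)
  show ?thesis
    by (subst v(2)) (simp add: br_simps cscale_def br_Je4_kernel[OF v(1)] br_Je4_J)
qed

lemma jacobi_e1_Je1_Je4: "br (br (J e4) e1) (J e1) = br (J (br (J e4) e1)) e1"
proof -
  have "br (br (J e4) e1) (J e1) = - br e1 (br (J e4) (J e1))"
    by (simp add: jacobi' br_Je4_kernel)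
  then show ?thesis using br_anticomm[of e1] by (simp add: br_Je4_J)
qed

text \<open>Every \<open>R = br (J e4) Y\<close> lies in \<open>U\<close>, and \<open>ad Y\<close> multiplies it by \<open>Im (w4 R)\<close> modulo \<open>C
2\<close>, since \<open>J e2\<close> contributes only to \<open>C 2\<close>; nilpotency gives \<open>w4 R = 0\<close>. The Jacobi
identity for \<open>e1, J e1, J e4\<close> becomes \<open>cnj (w2 P) * q = 0\<close> for \<open>P = br (J e4) e1\<close>,
where \<open>q = w3 (br (J e2) e1)\<close> is nonzero because \<open>J e2\<close> is not in \<open>C 2\<close>.\<close>

lemma Je4_in_C3_if_Je2_in_C3:
  assumes Je2: "J e2 \<in> C 3"
  shows "J e4 \<in> C 3"
proof -
  define P where "P = br (J e4) e1"
  have Im4: "Im (w4 (br (J e4) Y)) = 0" for Y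
  proof (cases "br (J e4) Y \<in> C 2")
    case True
    then show ?thesis by (simp add: C2_iff)
  next
    case False
    define R where "R = br (J e4) Y"
    obtain x where x: "x \<in> C 2" "R = x - Im (w2 R) *\<^sub>R J e2 - Im (w4 R) *\<^sub>R J e4"
      using kernel_split[of R] by (auto simp: R_def)
    have "br Y R = br Y x - Im (w2 R) *\<^sub>R br Y (J e2) + Im (w4 R) *\<^sub>R R"
      by (subst x(2), unfold R_def, subst br_anticomm[of "J e4" Y]) (simp add: br_simps)
    then have "(- Im (w4 R)) *\<^sub>R R + br Y R = br Y x - Im (w2 R) *\<^sub>R br Y (J e2)" by simp
    also have "\<dots> \<in> C 2"
      using C2D2[OF x(1)] C_mono[of 1 2] C3_D2[OF Je2] by (intro C_closed) auto
    finally have "- Im (w4 R) = 0" using no_real_eigenvalue False R_def by blast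
    then show ?thesis by (simp add: R_def)
  qed
  have p4: "w4 P = 0"
    using Im4[of e1] Im4[of "J e1"] by (simp add: br_Je4_J P_def complex_eq_iff)
  obtain x where x: "x \<in> C 2" "P = x - Im (w2 P) *\<^sub>R J e2"
    using kernel_split[of P] p4 by (auto simp: P_def)
  obtain x' where x': "x' \<in> C 2" "J P = x' + Re (w2 P) *\<^sub>R J e2"
    using kernel_split[of "J P"] p4 by (auto simp: P_def)
  define q where "q = w3 (br (J e2) e1)"
  have "w3 (br P (J e1)) = Im (w2 P) * (\<i> * q)"
    by (subst x(2)) (simp add: br_simps x(1) br_J_C2_J e2_C2 q_def scaleR_conv_of_real)
  moreover have "w3 (br (J P) e1) = Re (w2 P) * q"
    by (subst x'(2)) (simp add: br_simps x'(1) q_def scaleR_conv_of_real)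
  ultimately have "cnj (w2 P) * q = 0"
    using jacobi_e1_Je1_Je4 by (simp add: P_def complex_eq_iff)
  moreover have "q \<noteq> 0"
  proof
    assume q0: "q = 0"
    have Im2: "Im (w2 (br (J e2) Y)) = 0" "Im (w4 (br (J e2) Y)) = 0" for Y
      using C3_D[OF Je2, of Y] by (simp_all add: C2_iff)
    have "w2 (br (J e2) Y) = 0" for Y
      using Im2[of Y] Im2(1)[of "J Y"] br_J_C2_J(2)[OF e2_C2, of Y] by (simp add: complex_eq_iff)
    then have "br (J e2) e1 \<in> C 1" "br (J e2) (J e1) \<in> C 1"
      using Im2 q0 br_J_C2_J(3)[OF e2_C2, of e1] by (auto intro!: C1I simp: q_def)
    moreover have "br (J e2) Y = (Re (w1 Y) *\<^sub>R br (J e2) e1 - Im (w1 Y) *\<^sub>R br (J e2) (J e1))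
        + br (J e2) (Y - cscale J (w1 Y) e1)" for Y
      by (simp add: br_simps cscale_def)
    ultimately have "br (J e2) Y \<in> C 1" for Y
      using br_Je2_kernel[OF sub_e1_kernel] by (metis C_closed(1-3))
    then have "J e2 \<in> C 2" by (rule C2I)
    then show False by (simp add: C2_iff)
  qed
  ultimately have "w2 P = 0" by simp
  then have "P \<in> C 2" "J P \<in> C 2" using p4 by (simp_all add: C2_iff P_def)
  then show ?thesis
    by (intro C3_I, subst br_Je4) (auto simp: cscale_def P_def[symmetric] intro!: C_closed)
qed

text \<open>The element of \<open>C 3\<close> outside \<open>C 2\<close> that the ideal \<open>U\<close> contains is, modulo \<open>C 2\<close>, of the form
\<open>- J y\<close> with \<open>y\<close> in the real span of \<open>e2\<close> and \<open>e4\<close>.\<close>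

lemma Je4_in_C3_or_replace_e2:
  "J e4 \<in> C 3 \<or> (\<exists>y\<in>C 2. J y \<in> C 3 \<and> y \<notin> span {e3, J e3, e4})"
proof -
  have "\<not> {X. w1 X = 0} \<subseteq> C 2" using Je4_notin_C2 by (intro notI) (auto dest: subsetD[of _ _ "J e4"])
  then obtain u where u: "w1 u = 0" "u \<in> C (Suc 2)" "u \<notin> C 2"
    using ideal_meets_next_C[of "{X. w1 X = 0}" 2] by auto
  then have u3: "u \<in> C 3" by simp
  obtain x where x: "x \<in> C 2" "u = x - Im (w2 u) *\<^sub>R J e2 - Im (w4 u) *\<^sub>R J e4"
    using kernel_split[OF u(1)] by blast
  let ?y = "Im (w2 u) *\<^sub>R e2 + Im (w4 u) *\<^sub>R e4"
  have "J ?y = x - u" by (subst x(2)) (simp add: J_simps)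
  moreover have "x \<in> C 3" using x(1) C_mono[of 2 3] by auto
  ultimately have Jy: "J ?y \<in> C 3" using u3 C_closed(2) by simp
  have y2: "?y \<in> C 2" by (intro C_closed e2_C2 e4_C2)
  show ?thesis
  proof (cases "Im (w2 u) = 0")
    case True
    then have "Im (w4 u) \<noteq> 0" using u by (auto simp: C2_iff)
    moreover have "Im (w4 u) *\<^sub>R J e4 \<in> C 3" using Jy True by (simp add: J_simps)
    ultimately have "J e4 \<in> C 3"
      using C_closed(3)[of "Im (w4 u) *\<^sub>R J e4" 3 "inverse (Im (w4 u))"] by simp
    then show ?thesis ..
  next
    case False
    have "?y \<notin> span {e3, J e3, e4}"
    proof
      assume "?y \<in> span {e3, J e3, e4}"
      from linear_eq_0_on_span[OF w_lin(2) _ this] have "w2 ?y = 0" by fastforce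
      then show False using False by simp
    qed
    then show ?thesis using Jy y2 by blast
  qed
qed

end

section \<open>The structure equations of a normalised frame\<close>

text \<open>The extra condition confines the image of \<open>ad (J e4)\<close> to the complex line of \<open>e3\<close>;
from this the remaining brackets follow.\<close>

locale normalised_frame = adapted_frame br J e1 e2 e3 e4 w1 w2 w3 w4
  for br :: "'g::real_vector \<Rightarrow> 'g \<Rightarrow> 'g" and J e1 e2 e3 e4 w1 w2 w3 w4 +
  assumes Je4_C3: "J e4 \<in> C 3"
begin

text \<open>The image of \<open>ad (J e4)\<close> is a \<open>J\<close>-invariant subspace of \<open>C 2\<close>, where the imaginary
parts of \<open>w2\<close> and \<open>w4\<close> vanish; by invariance the real parts vanish as well.\<close>

lemma w24_br_Je4 [simp]:
  "w2 (br (J e4) Y) = 0" "w4 (br (J e4) Y) = 0"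
proof -
  have "Im (w2 (br (J e4) Y)) = 0 \<and> Im (w4 (br (J e4) Y)) = 0" for Y
    using C3_D[OF Je4_C3, of Y] by (simp add: C2_iff)
  from this[of Y] this[of "J Y"] show "w2 (br (J e4) Y) = 0" "w4 (br (J e4) Y) = 0"
    by (simp_all add: br_Je4_J complex_eq_iff)
qed

definition p :: complex where "p = w3 (br (J e4) e1)"

lemma w3_br_Je4 [simp]: "w3 (br (J e4) Y) = w1 Y * p"
  by (subst br_Je4) (simp add: p_def)

lemma p_nonzero: "p \<noteq> 0"
proof
  assume "p = 0"
  then have "br (J e4) Y \<in> C 1" for Y by (intro C1I) simp_all
  then have "J e4 \<in> C 2" by (rule C2I)
  then show False using Je4_notin_C2 by blast
qed

text \<open>As \<open>J e4\<close> is in \<open>C 3\<close>, the vector \<open>J e2\<close>, unless it is in \<open>C 3\<close> too, is an eigenvector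
of \<open>ad Y\<close> modulo \<open>C 3\<close>, with eigenvalue \<open>Im (w2 (br (J e2) Y))\<close>.\<close>

lemma w2_br_Je2 [simp]: "w2 (br (J e2) Y) = 0"
proof -
  have Im2: "Im (w2 (br (J e2) Y)) = 0" for Y
  proof (cases "J e2 \<in> C 3")
    case True
    then show ?thesis using C3_D[of "J e2" Y] by (simp add: C2_iff)
  next
    case False
    define R where "R = br (J e2) Y"
    obtain x where x: "x \<in> C 2" "R = x - Im (w2 R) *\<^sub>R J e2 - Im (w4 R) *\<^sub>R J e4"
      using kernel_split[of R] by (auto simp: R_def)
    have xR: "x = R + Im (w2 R) *\<^sub>R J e2 + Im (w4 R) *\<^sub>R J e4"
      using x(2) by (simp add: algebra_simps)
    have "(- Im (w2 R)) *\<^sub>R J e2 + br Y (J e2) = - (x - Im (w4 R) *\<^sub>R J e4)"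
      using br_anticomm[of Y "J e2"] by (subst xR) (simp add: R_def)
    also have "\<dots> \<in> C 3"
      using x(1) C_mono[of 2 3] Je4_C3 by (intro C_closed) auto
    finally have "- Im (w2 R) = 0" using no_real_eigenvalue False by blast
    then show ?thesis by (simp add: R_def)
  qed
  from Im2[of Y] Im2[of "J Y"] show ?thesis
    using br_J_C2_J(2)[OF e2_C2, of Y] by (simp add: complex_eq_iff)
qed

definition q :: complex where "q = w3 (br (J e2) e1)"

lemma w3_br_Je2 [simp]: "w3 (br (J e2) Y) = w1 Y * q"
proof -
  obtain v where v: "w1 v = 0" "Y = cscale J (w1 Y) e1 + v" by (rule decompose_e1)
  have "w3 (br (J e2) v) = 0" using C1_coords(3)[OF br_Je2_kernel[OF v(1)]] .
  then show ?thesis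
    by (subst v(2)) (simp add: br_simps cscale_def br_J_C2_J(3)[OF e2_C2] q_def[symmetric]
        complex_eq_iff algebra_simps)
qed

text \<open>In the Jacobi identity for \<open>e1, J e1, J e2\<close> the double bracket inside \<open>U\<close> is central.
In the other two, \<open>w3\<close> sees only the component of the inner bracket along \<open>J e4\<close>,
multiplied by the nonzero constant \<open>p\<close>.\<close>

lemma Im_w4_br_Je2_e1: "Im (w4 (br (J e2) e1)) = 0" "Im (w4 (br (J e2) (J e1))) = 0"
proof -
  define Q R where "Q = br (J e2) e1" and "R = br (J e2) (J e1)"
  have "br (br e1 (J e1)) (J e2) = br R e1 - br Q (J e1)"
    unfolding jacobi'[of e1] Q_def R_def
    using br_anticomm[of "J e1" "J e2"] br_anticomm[of e1 "J e2"]
      br_anticomm[of e1 "br (J e2) (J e1)"] br_anticomm[of "J e1" "br (J e2) e1"]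
    by (simp add: br_simps)
  moreover have "br (br e1 (J e1)) (J e2) \<in> C 1" by (rule br_kernel_kernel) simp_all
  ultimately have eq: "w3 (br R e1) = w3 (br Q (J e1))"
    using C1_coords(3)[of "br R e1 - br Q (J e1)"] by simp
  obtain x where x: "x \<in> C 2" "R = x - Im (w4 R) *\<^sub>R J e4"
    using kernel_split[of R] by (auto simp: R_def)
  obtain y where y: "y \<in> C 2" "Q = y - Im (w4 Q) *\<^sub>R J e4"
    using kernel_split[of Q] by (auto simp: Q_def)
  have "w3 (br R e1) = - Im (w4 R) * p"
    by (subst x(2)) (simp add: br_simps x(1) scaleR_conv_of_real)
  moreover have "w3 (br Q (J e1)) = Im (w4 Q) * (\<i> * p)"
    by (subst y(2)) (simp add: br_simps y(1) scaleR_conv_of_real)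
  ultimately have "(of_real (Im (w4 R)) + \<i> * of_real (Im (w4 Q))) * p = 0"
    using eq by (simp add: algebra_simps)
  then have "of_real (Im (w4 R)) + \<i> * of_real (Im (w4 Q)) = 0" using p_nonzero by simp
  then show "Im (w4 (br (J e2) e1)) = 0" "Im (w4 (br (J e2) (J e1))) = 0"
    by (simp_all add: complex_eq_iff Q_def R_def)
qed

lemma Im_w4_br_Je2 [simp]: "Im (w4 (br (J e2) Y)) = 0"
proof -
  obtain v where v: "w1 v = 0" "Y = cscale J (w1 Y) e1 + v" by (rule decompose_e1)
  have "Im (w4 (br (J e2) v)) = 0" using C1_coords(4)[OF br_Je2_kernel[OF v(1)]] .
  then show ?thesis
    by (subst v(2)) (simp add: br_simps cscale_def Im_w4_br_Je2_e1)
qed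

lemma br_kernel_coords:
  assumes "w1 u = 0"
  shows "w2 (br u Y) = 0"
    and "w3 (br u Y) = - w1 Y * (of_real (Im (w2 u)) * q + of_real (Im (w4 u)) * p)"
proof -
  obtain x where x: "x \<in> C 2" "u = x - Im (w2 u) *\<^sub>R J e2 - Im (w4 u) *\<^sub>R J e4"
    using kernel_split[OF assms] by blast
  show "w2 (br u Y) = 0"
    by (subst x(2)) (simp add: br_simps x(1))
  show "w3 (br u Y) = - w1 Y * (of_real (Im (w2 u)) * q + of_real (Im (w4 u)) * p)"
    by (subst x(2)) (simp add: br_simps x(1) scaleR_conv_of_real algebra_simps)
qed

text \<open>The line of \<open>e3\<close> is the image of \<open>ad (J e4)\<close>, which kills \<open>U\<close>; as all brackets lie in
\<open>U\<close>, the Jacobi identity makes this image commute with \<open>U\<close>.\<close>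

lemma br_e3_kernel:
  assumes v: "w1 v = 0"
  shows "br (cscale J c e3) v = 0"
proof -
  let ?Y = "cscale J (c / p) e1"
  have "cscale J c e3 = br (J e4) ?Y"
    using expand[of "br (J e4) ?Y"] p_nonzero by (simp add: cscale_def[of _ 0])
  also have "br (br (J e4) ?Y) v = br (J e4) (br ?Y v) - br ?Y (br (J e4) v)" by (rule jacobi')
  also have "\<dots> = 0" by (simp add: br_Je4_kernel v br_simps)
  finally show ?thesis .
qed

text \<open>When the relevant values of \<open>w4\<close> are real, the real part of the Nijenhuis identity
says that the pairing \<open>w4 (br y Y)\<close> is \<open>J\<close>-invariant. This is what makes the
differential of \<open>w4\<close> of type (1,1).\<close>

lemma w4_br_J_J:
  assumes y: "y \<in> C 2" and real: "\<And>Y. Im (w4 (br (J y) Y)) = 0"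
  shows "w4 (br (J y) (J Y)) = w4 (br y Y)"
  using nijenhuis[of y Y] real[of Y] real[of "J Y"] br_C2_coords(4)[OF y]
  by (simp add: complex_eq_iff)

text \<open>The complex number representing the real functional \<open>d \<mapsto> w4 (br y (cscale J d e1))\<close>,
normalised to be the coefficient of \<open>w1 \<and> cnj w2\<close> (for \<open>y = e2\<close>) or of \<open>w1 \<and> cnj w3\<close>
(for \<open>y = e3\<close>) in the differential of \<open>w4\<close>.\<close>

definition half_pairing :: "'g \<Rightarrow> complex" where
  "half_pairing y = (w4 (br y e1) + \<i> * w4 (br y (J e1))) / 2"

lemma w4_br_cscale_e1:
  assumes y: "y \<in> C 2" and real: "\<And>Y. Im (w4 (br (J y) Y)) = 0"
  shows "w4 (br (cscale J c y) (cscale J d e1)) = of_real (2 * Re (half_pairing y * d * cnj c))"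
proof -
  have a: "w4 (br (J y) (J e1)) = w4 (br y e1)" by (rule w4_br_J_J[OF assms])
  have b: "w4 (br (J y) e1) = - w4 (br y (J e1))"
    using w4_br_J_J[OF assms, of "J e1"] by (simp add: br_simps minus_equation_iff)
  have c: "Im (w4 (br y e1)) = 0" "Im (w4 (br y (J e1))) = 0"
    using br_C2_coords(4)[OF y] by blast+
  show ?thesis
    by (simp add: cscale_def[of J] br_simps a b complex_eq_iff c half_pairing_def algebra_simps)
qed

lemma br_cscale_cscale:
  "br (cscale J c y) (cscale J d y) = - Im (c * cnj d) *\<^sub>R br (J y) y"
  using br_anticomm[of y "J y"] by (simp add: cscale_def br_simps algebra_simps)

text \<open>The component of \<open>u\<close> along \<open>e3\<close> pairs only with the \<open>e1\<close> component of \<open>Y\<close>, because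
\<open>e3\<close> commutes with \<open>U\<close>; the \<open>e4\<close> component of \<open>u\<close> contributes nothing, since \<open>e4\<close> is
central and brackets with \<open>J e4\<close> have no \<open>w4\<close>-component.\<close>

lemma w4_br_kernel:
  assumes u: "w1 u = 0"
  shows "w4 (br u Y) = of_real (2 * Re (half_pairing e2 * w1 Y * cnj (w2 u))
    + 2 * Re (half_pairing e3 * w1 Y * cnj (w3 u)) - Im (w2 u * cnj (w2 Y)) * Re (w4 (br (J e2) e2)))"
proof -
  let ?u2 = "cscale J (w2 u) e2" and ?u3 = "cscale J (w3 u) e3" and ?u4 = "cscale J (w4 u) e4"
  let ?Y1 = "cscale J (w1 Y) e1" and ?Y2 = "cscale J (w2 Y) e2"
  let ?v = "Y - ?Y1"
  have v: "w1 ?v = 0" by simp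
  have uu: "u = ?u2 + ?u3 + ?u4"
    using expand[of u] u by (simp add: cscale_def)
  have u4: "w4 (br ?u4 Y) = 0"
    by (simp add: cscale_def br_simps C1D(1)[OF e4_C1])
  have u3: "w4 (br ?u3 Y) = of_real (2 * Re (half_pairing e3 * w1 Y * cnj (w3 u)))"
  proof -
    have "br ?u3 Y = br ?u3 ?Y1 + br ?u3 ?v" by (simp add: br_simps)
    then show ?thesis
      using w4_br_cscale_e1[OF e3_C2 br_C2_coords(4)[OF Je3_C2]] br_e3_kernel[OF v] by simp
  qed
  have u2: "w4 (br ?u2 Y) = of_real (2 * Re (half_pairing e2 * w1 Y * cnj (w2 u))
      - Im (w2 u * cnj (w2 Y)) * Re (w4 (br (J e2) e2)))"
  proof -
    have k2: "w1 ?u2 = 0" by simp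
    have "Y = ?Y1 + ?Y2 + cscale J (w3 Y) e3 + cscale J (w4 Y) e4" by (rule expand)
    then have "br ?u2 Y = br ?u2 (?Y1 + ?Y2 + cscale J (w3 Y) e3 + cscale J (w4 Y) e4)" by simp
    also have "\<dots> = br ?u2 ?Y1 + br ?u2 ?Y2 + br ?u2 (cscale J (w3 Y) e3) + br ?u2 (cscale J (w4 Y) e4)"
      by (simp add: br_simps)
    also have "br ?u2 (cscale J (w3 Y) e3) = 0"
      using br_e3_kernel[OF k2] br_anticomm[of ?u2] by simp
    also have "br ?u2 (cscale J (w4 Y) e4) = 0"
      by (simp add: cscale_def[of J "w4 Y"] br_simps(2,4,8) C1D(2)[OF e4_C1] br_Je4_kernel[OF k2])
    finally have "w4 (br ?u2 Y) = w4 (br ?u2 ?Y1) + w4 (br ?u2 ?Y2)" by simp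
    moreover have "w4 (br ?u2 ?Y2) = of_real (- Im (w2 u * cnj (w2 Y)) * Re (w4 (br (J e2) e2)))"
      unfolding br_cscale_cscale by (simp add: complex_eq_iff)
    ultimately show ?thesis
      using w4_br_cscale_e1[OF e2_C2 Im_w4_br_Je2] by (simp add: algebra_simps)
  qed
  show ?thesis
    by (subst uu) (simp add: br_simps u2 u3 u4 del: w_simps(15))
qed

lemma bilinear_wedge:
  assumes "linear a" "linear b" shows "bilinear (wedge a b)"
  using assms by (auto simp: bilinear_def linear_iff wedge_def algebra_simps scaleR_conv_of_real)

text \<open>Such a form descends to the quotient by \<open>U\<close>, a real plane, on which all 2-forms are
proportional. The denominator is the value of \<open>w1 \<and> cnj w1\<close> at \<open>e1, J e1\<close>.\<close>

lemma alternating_factor: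
  fixes \<theta> :: "'g \<Rightarrow> 'g \<Rightarrow> complex"
  assumes bil: "bilinear \<theta>" and alt: "\<And>X. \<theta> X X = 0"
    and van: "\<And>u Y. w1 u = 0 \<Longrightarrow> \<theta> u Y = 0"
  shows "\<theta> X Y = (\<theta> e1 (J e1) / (2 * \<i>)) * wedge w1 (conj_form w1) X Y"
proof -
  note bs = bilinear_ladd[OF bil] bilinear_radd[OF bil] bilinear_lmul[OF bil] bilinear_rmul[OF bil]
    bilinear_lsub[OF bil] bilinear_rsub[OF bil]
  have anti: "\<theta> X Y = - \<theta> Y X" for X Y
  proof -
    have "\<theta> (X + Y) (X + Y) = 0" by (rule alt)
    then show ?thesis unfolding bs by (simp add: alt eq_neg_iff_add_eq_0 add.commute)
  qed
  have van': "\<theta> Y u = 0" if "w1 u = 0" for u Y using anti[of Y u] van[OF that] by simp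
  obtain u where u: "w1 u = 0" "X = cscale J (w1 X) e1 + u" by (rule decompose_e1)
  obtain v where v: "w1 v = 0" "Y = cscale J (w1 Y) e1 + v" by (rule decompose_e1)
  have "\<theta> X Y = \<theta> (cscale J (w1 X) e1) (cscale J (w1 Y) e1)"
    by (subst u(2), subst v(2)) (simp add: bs van[OF u(1)] van'[OF v(1)])
  also have "\<dots> = of_real (Im (w1 X) * Re (w1 Y) - Re (w1 X) * Im (w1 Y)) * \<theta> e1 (J e1)"
    using anti[of "J e1" e1]
    by (simp add: cscale_def bs alt scaleR_conv_of_real algebra_simps)
  also have "of_real (Im (w1 X) * Re (w1 Y) - Re (w1 X) * Im (w1 Y)) =
      wedge w1 (conj_form w1) X Y / (2 * \<i>)"
    by (simp add: wedge_def conj_form_def complex_eq_iff Re_divide Im_divide power2_eq_square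
        field_simps)
  finally show ?thesis by simp
qed

lemma bilinear_d1:
  assumes "linear a" shows "bilinear (d1 br a)"
  using assms by (auto simp: bilinear_def linear_iff d1_def br_simps)

text \<open>The constants of the mixed terms are read off from the brackets of \<open>e2\<close>, \<open>e3\<close>, \<open>J e2\<close> and
\<open>J e4\<close>; after subtracting these terms, \<open>alternating_factor\<close> supplies the coefficients of
\<open>w1 \<and> cnj w1\<close>.\<close>

lemma structure_constants:
  obtains A D E F L M N and s :: real where
    "\<And>X Y. d1 br w1 X Y = 0"
    "\<And>X Y. d1 br w2 X Y = A * wedge w1 (conj_form w1) X Y"
    "\<And>X Y. d1 br w3 X Y = - D * (wedge w1 w2 X Y - wedge w1 (conj_form w2) X Y)
           - E * (wedge w1 w4 X Y - wedge w1 (conj_form w4) X Y) + F * wedge w1 (conj_form w1) X Y"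
    "\<And>X Y. d1 br w4 X Y = L * wedge w1 (conj_form w1) X Y + M * wedge w1 (conj_form w2) X Y
           + N * wedge w1 (conj_form w3) X Y
           - cnj M * wedge w2 (conj_form w1) X Y + \<i> * of_real s * wedge w2 (conj_form w2) X Y
           - cnj N * wedge w3 (conj_form w1) X Y"
proof -
  have lc: "linear (conj_form a)" if "linear a" for a :: "'g \<Rightarrow> complex"
    using that by (simp add: linear_iff conj_form_def)
  have badd: "bilinear (\<lambda>X Y. f X Y + g X Y)" "bilinear (\<lambda>X Y. f X Y - g X Y)"
    if "bilinear f" "bilinear g" for f g :: "'g \<Rightarrow> 'g \<Rightarrow> complex"
    using that by (auto simp: bilinear_def linear_iff algebra_simps)
  have bscale: "bilinear (\<lambda>X Y. c * f X Y)"
    if "bilinear f" for f :: "'g \<Rightarrow> 'g \<Rightarrow> complex" and c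
    using that by (auto simp: bilinear_def linear_iff algebra_simps)
  \<comment> \<open>The form \<open>w1 \<and> (w4 - cnj w4)\<close> takes the value \<open>2 \<i>\<close> at \<open>J e4, e1\<close>, where the differential of
    \<open>w3\<close> is \<open>- p\<close>; likewise for \<open>D\<close> with \<open>J e2\<close> and \<open>q\<close>.\<close>
  define D E where "D = q / (2 * \<i>)" and "E = p / (2 * \<i>)"
  define M N where "M = half_pairing e2" and "N = half_pairing e3"
  \<comment> \<open>The 2-form \<open>\<i> w2 \<and> cnj w2\<close> takes the value \<open>- 2\<close> at \<open>e2, J e2\<close>.\<close>
  define s where "s = - Re (w4 (br (J e2) e2)) / 2"
  let ?t3 = "\<lambda>X Y. d1 br w3 X Y + D * (wedge w1 w2 X Y - wedge w1 (conj_form w2) X Y)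
           + E * (wedge w1 w4 X Y - wedge w1 (conj_form w4) X Y)"
  let ?t4 = "\<lambda>X Y. d1 br w4 X Y - M * wedge w1 (conj_form w2) X Y
           - N * wedge w1 (conj_form w3) X Y
           + cnj M * wedge w2 (conj_form w1) X Y - \<i> * of_real s * wedge w2 (conj_form w2) X Y
           + cnj N * wedge w3 (conj_form w1) X Y"
  have t2: "d1 br w2 X Y = d1 br w2 e1 (J e1) / (2 * \<i>) * wedge w1 (conj_form w1) X Y" for X Y
    by (rule alternating_factor[OF bilinear_d1[OF w_lin(2)]]) (auto simp: d1_def br_kernel_coords(1))
  have t3: "?t3 X Y = ?t3 e1 (J e1) / (2 * \<i>) * wedge w1 (conj_form w1) X Y" for X Y
  proof (rule alternating_factor)
    show "bilinear ?t3"
      by (intro badd bscale bilinear_d1 bilinear_wedge lc w_lin)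
    show "?t3 X X = 0" for X by (simp add: d1_def wedge_def)
    show "?t3 u Y = 0" if u: "w1 u = 0" for u Y
    proof -
      have qp: "q = 2 * \<i> * D" "p = 2 * \<i> * E" by (simp_all add: D_def E_def)
      have im: "w2 u - cnj (w2 u) = 2 * \<i> * of_real (Im (w2 u))"
        "w4 u - cnj (w4 u) = 2 * \<i> * of_real (Im (w4 u))"
        by (simp_all add: complex_eq_iff)
      have "?t3 u Y = w1 Y * (of_real (Im (w2 u)) * q + of_real (Im (w4 u)) * p)
          - D * w1 Y * (w2 u - cnj (w2 u)) - E * w1 Y * (w4 u - cnj (w4 u))"
        by (simp add: d1_def wedge_def conj_form_def br_kernel_coords(2)[OF u] u algebra_simps)
      also have "\<dots> = 0" unfolding im qp by (simp add: algebra_simps)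
      finally show ?thesis .
    qed
  qed
  have t4: "?t4 X Y = ?t4 e1 (J e1) / (2 * \<i>) * wedge w1 (conj_form w1) X Y" for X Y
  proof (rule alternating_factor)
    show "bilinear ?t4"
      by (intro badd bscale bilinear_d1 bilinear_wedge lc w_lin)
    show "?t4 X X = 0" for X by (simp add: d1_def wedge_def conj_form_def)
    show "?t4 u Y = 0" if u: "w1 u = 0" for u Y
    proof -
      have "Re (w4 (br (J e2) e2)) = - 2 * s" by (simp add: s_def)
      then have "w4 (br u Y) = of_real (2 * Re (M * w1 Y * cnj (w2 u))
          + 2 * Re (N * w1 Y * cnj (w3 u)) + 2 * s * Im (w2 u * cnj (w2 Y)))"
        using w4_br_kernel[OF u, of Y] by (simp add: M_def N_def algebra_simps)
      then show ?thesis
        by (simp add: d1_def wedge_def conj_form_def u complex_eq_iff algebra_simps)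
    qed
  qed
  define F L where "F = ?t3 e1 (J e1) / (2 * \<i>)" and "L = ?t4 e1 (J e1) / (2 * \<i>)"
  show ?thesis
  proof (rule that[of "d1 br w2 e1 (J e1) / (2 * \<i>)" D E F L M N s])
    fix X Y
    show "d1 br w1 X Y = 0" by (simp add: d1_def)
    show "d1 br w2 X Y = d1 br w2 e1 (J e1) / (2 * \<i>) * wedge w1 (conj_form w1) X Y" by (rule t2)
    show "d1 br w3 X Y = - D * (wedge w1 w2 X Y - wedge w1 (conj_form w2) X Y)
        - E * (wedge w1 w4 X Y - wedge w1 (conj_form w4) X Y) + F * wedge w1 (conj_form w1) X Y"
      using t3[of X Y, folded F_def] by (simp add: algebra_simps)
    show "d1 br w4 X Y = L * wedge w1 (conj_form w1) X Y + M * wedge w1 (conj_form w2) X Y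
        + N * wedge w1 (conj_form w3) X Y
        - cnj M * wedge w2 (conj_form w1) X Y + \<i> * of_real s * wedge w2 (conj_form w2) X Y
        - cnj N * wedge w3 (conj_form w1) X Y"
      using t4[of X Y, folded L_def] by (simp add: algebra_simps)
  qed
qed

end

section \<open>Reading the third central term off the structure equations\<close>

lemma structure_equationsD:
  assumes "structure_equations br \<omega> A D E F L M N s"
  shows "\<omega> 1 (br X Y) = 0" "- \<omega> 2 (br X Y) = A * wedge (\<omega> 1) (conj_form (\<omega> 1)) X Y"
    "- \<omega> 3 (br X Y) = - D * (wedge (\<omega> 1) (\<omega> 2) X Y - wedge (\<omega> 1) (conj_form (\<omega> 2)) X Y)
           - E * (wedge (\<omega> 1) (\<omega> 4) X Y - wedge (\<omega> 1) (conj_form (\<omega> 4)) X Y)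
           + F * wedge (\<omega> 1) (conj_form (\<omega> 1)) X Y"
    "- \<omega> 4 (br X Y) = L * wedge (\<omega> 1) (conj_form (\<omega> 1)) X Y + M * wedge (\<omega> 1) (conj_form (\<omega> 2)) X Y
           + N * wedge (\<omega> 1) (conj_form (\<omega> 3)) X Y
           - cnj M * wedge (\<omega> 2) (conj_form (\<omega> 1)) X Y
           + \<i> * of_real s * wedge (\<omega> 2) (conj_form (\<omega> 2)) X Y
           - cnj N * wedge (\<omega> 3) (conj_form (\<omega> 1)) X Y"
  using assms unfolding structure_equations_def Let_def d1_def by auto

context snn_type_1_4
begin

text \<open>When \<open>\<omega> 1 X = 0\<close> and \<open>\<omega> 2 X\<close>, \<open>\<omega> 4 X\<close> are real, the equations leave only a real \<open>\<omega>
4\<close>-component in \<open>br X Y\<close>, and a vector with just that component is central.\<close>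

lemma C2_contains_kernel:
  assumes b: "basis10 J \<omega>" and st: "structure_equations br \<omega> A D E F L M N s"
    and V: "\<omega> 1 X = 0" "Im (\<omega> 2 X) = 0" "Im (\<omega> 4 X) = 0"
  shows "X \<in> C 2"
proof (rule C2I)
  fix Y
  note st' = structure_equationsD[OF st]
  have c2: "cnj (\<omega> 2 X) = \<omega> 2 X" and c4: "cnj (\<omega> 4 X) = \<omega> 4 X"
    using V by (simp_all add: complex_eq_iff)
  have B: "\<omega> 1 (br X Y) = 0" "\<omega> 2 (br X Y) = 0" "\<omega> 3 (br X Y) = 0"
    using st'(1-3)[of X Y] V(1) c2 c4 by (simp_all add: wedge_def conj_form_def)
  have "Im (- \<omega> 4 (br X Y)) = 0"
    unfolding st'(4) using V by (simp add: wedge_def conj_form_def algebra_simps)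
  then have B4: "Im (\<omega> 4 (br X Y)) = 0" by simp
  have "br (br X Y) Z = 0" for Z
  proof (rule basis10_separates[OF J_linear JJ b])
    fix k :: nat assume "k \<in> {1..4}"
    then have "k = 1 \<or> k = 2 \<or> k = 3 \<or> k = 4" by auto
    moreover have "cnj (\<omega> 4 (br X Y)) = \<omega> 4 (br X Y)" using B4 by (simp add: complex_eq_iff)
    ultimately show "\<omega> k (br (br X Y) Z) = 0"
      using st'[of "br X Y" Z] B by (elim disjE) (simp_all add: wedge_def conj_form_def)
  qed
  then show "br X Y \<in> C 1" by (simp add: C1_iff)
qed

text \<open>The length of the ascending type is the nilpotency step; in the second case its third
entry also says that \<open>C 3\<close> has dimension six.\<close>

lemma C3_eq_UNIV_from_type:
  shows "ascending_type br = [1, 4, 8] \<Longrightarrow> C 3 = UNIV"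
    and "ascending_type br = [1, 4, 6, 8] \<Longrightarrow> C 3 \<noteq> UNIV"
proof -
  let ?r = "nilpotency_step br"
  obtain r where r: "C r = UNIV" by (rule C_UNIV)
  then have "C (Suc r) = UNIV" using C_le_Suc[of r] by auto
  then have U: "C ?r = UNIV"
    unfolding nilpotency_step_def
    using LeastI[of "\<lambda>r. r \<ge> 1 \<and> C r = UNIV" "Suc r"] by auto
  have len: "length (ascending_type br) = ?r"
    by (simp add: ascending_type_def)
  show "C 3 = UNIV" if "ascending_type br = [1, 4, 8]"
  proof -
    have "?r = 3" using len that by simp
    then show ?thesis using U by simp
  qed
  show "C 3 \<noteq> UNIV" if t: "ascending_type br = [1, 4, 6, 8]"
  proof -
    have r4: "?r = 4" using len t by simp
    have "ascending_type br ! 2 = dim (C 3)"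
      unfolding ascending_type_def r4 by (simp add: nth_append upt_rec)
    then show ?thesis using t dim8 by auto
  qed
qed

text \<open>The imaginary parts of \<open>\<omega> 2\<close> and \<open>\<omega> 4\<close> on \<open>br X Y\<close> are \<open>Re A\<close> and \<open>Re L\<close> times one
real 2-form, which is nonzero at \<open>X, J X\<close> whenever \<open>\<omega> 1 X \<noteq> 0\<close>; and \<open>C 3\<close> is
everything iff all brackets lie in \<open>C 2\<close>, the common kernel.\<close>

lemma C3_eq_UNIV_iff_real_parts_vanish:
  assumes b: "basis10 J \<omega>" and st: "structure_equations br \<omega> A D E F L M N s"
  shows "C 3 = UNIV \<longleftrightarrow> (Re A, Re L) = (0, 0)"
proof -
  have lin: "linear (\<omega> 1)" "linear (\<omega> 2)" "linear (\<omega> 4)" and w1: "\<omega> 1 \<in> forms10 J"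
  proof -
    have "\<omega> k \<in> forms10 J" if "k \<in> {1..4}" for k
      using b that unfolding basis10_def by (metis cform.span_base imageI)
    then show "linear (\<omega> 1)" "linear (\<omega> 2)" "linear (\<omega> 4)" "\<omega> 1 \<in> forms10 J"
      by (auto intro!: forms10_linear[of _ J])
  qed
  have C2: "X \<in> C 2 \<longleftrightarrow> \<omega> 1 X = 0 \<and> Im (\<omega> 2 X) = 0 \<and> Im (\<omega> 4 X) = 0" for X
    using C2_eq_kernel[OF lin C2_contains_kernel[OF b st]] .
  note st' = structure_equationsD[OF st]
  let ?h = "\<lambda>X Y. Im (\<omega> 1 Y * cnj (\<omega> 1 X)) * 2"
  have Im: "Im (\<omega> 2 (br X Y)) = Re A * ?h X Y" "Im (\<omega> 4 (br X Y)) = Re L * ?h X Y" for X Y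
  proof -
    have "Im (- \<omega> 2 (br X Y)) = - (Re A * ?h X Y)" "Im (- \<omega> 4 (br X Y)) = - (Re L * ?h X Y)"
      unfolding st' by (simp_all add: wedge_def conj_form_def algebra_simps)
    then show "Im (\<omega> 2 (br X Y)) = Re A * ?h X Y" "Im (\<omega> 4 (br X Y)) = Re L * ?h X Y"
      by simp_all
  qed
  have C3: "C 3 = UNIV \<longleftrightarrow> (\<forall>X Y. br X Y \<in> C 2)"
    using C3_D by (auto intro: C3_I)
  obtain X where X: "\<omega> 1 X \<noteq> 0"
  proof -
    have "cform.independent (\<omega> ` {1..4})" using b by (simp add: basis10_def)
    then have "0 \<notin> \<omega> ` {1..4}" using cform.dependent_zero by blast
    then have "\<omega> 1 \<noteq> 0" by (metis atLeastAtMost_iff image_eqI one_le_numeral order_refl)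
    then show ?thesis using that by (auto simp: fun_eq_iff)
  qed
  have "?h X (J X) = - 2 * ((Re (\<omega> 1 X))\<^sup>2 + (Im (\<omega> 1 X))\<^sup>2)"
    by (simp add: forms10_J[OF w1] power2_eq_square)
  moreover have "(Re (\<omega> 1 X))\<^sup>2 + (Im (\<omega> 1 X))\<^sup>2 \<noteq> 0"
    using X by (simp add: complex_eq_iff)
  ultimately have "?h X (J X) \<noteq> 0"
    by (metis mult_eq_0_iff neg_equal_0_iff_equal zero_neq_numeral)
  then show ?thesis
    unfolding C3 C2 Im st'(1) by auto
qed

end

section \<open>Existence of a normalised frame\<close>

context snn_type_1_4
begin

lemma adapted_frame_of_frame:
  assumes fr: "frame J {1..4} e \<omega> UNIV"
    and "e 4 \<in> C 1" "e 2 \<in> C 2" "e 3 \<in> C 2" "J (e 3) \<in> C 2"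
  shows "adapted_frame br J (e 1) (e 2) (e 3) (e 4) (\<omega> 1) (\<omega> 2) (\<omega> 3) (\<omega> 4)"
proof -
  have w: "\<And>k. k \<in> {1..4} \<Longrightarrow> \<omega> k \<in> forms10 J"
    and dual: "\<And>j k. j \<in> {1..4} \<Longrightarrow> k \<in> {1..4} \<Longrightarrow> \<omega> j (e k) = (if j = k then 1 else 0)"
    and ex: "\<And>X. X = (\<Sum>k\<in>{1..4}. cscale J (\<omega> k X) (e k))"
    using fr unfolding frame_def by blast+
  have "{1..4} = {1,2,3,4::nat}" by auto
  then have "X = cscale J (\<omega> 1 X) (e 1) + cscale J (\<omega> 2 X) (e 2) + cscale J (\<omega> 3 X) (e 3)
      + cscale J (\<omega> 4 X) (e 4)" for X
    using ex[of X] by (simp add: algebra_simps)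
  then show ?thesis
    by unfold_locales (use assms w dual in simp_all)
qed

text \<open>The property \<open>J Z \<in> C 3\<close> does not mention the second basis vector, so it may be proved in an
auxiliary frame with a better second vector and then used in the original one.\<close>

lemma normalised_frame_exists:
  obtains e \<omega> where "frame J {1..4} e \<omega> UNIV"
    "normalised_frame br J (e 1) (e 2) (e 3) (e 4) (\<omega> 1) (\<omega> 2) (\<omega> 3) (\<omega> 4)"
proof -
  obtain Z where Z: "Z \<in> C 1" "Z \<noteq> 0" by (rule C1_nonzero)
  obtain W where W: "W \<noteq> 0" "W \<in> C 2" "J W \<in> C 2" by (rule C2_J_invariant_part_nonzero)
  obtain X where X: "X \<in> C 2" "X \<notin> span {W, J W, Z}" by (rule C2_complement_exists)
  obtain e \<omega> where f: "frame J {1..4} e \<omega> UNIV" "e 2 = X" "e 3 = W" "e 4 = Z"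
    by (rule adapted_frame_exists[OF Z W X])
  interpret a: adapted_frame br J "e 1" "e 2" "e 3" "e 4" "\<omega> 1" "\<omega> 2" "\<omega> 3" "\<omega> 4"
    by (rule adapted_frame_of_frame) (use f Z W X in simp_all)
  have "J Z \<in> C 3"
  proof (rule disjE[OF a.Je4_in_C3_or_replace_e2])
    assume "\<exists>y\<in>C 2. J y \<in> C 3 \<and> y \<notin> span {e 3, J (e 3), e 4}"
    then obtain y where y: "y \<in> C 2" "J y \<in> C 3" "y \<notin> span {W, J W, Z}" using f by auto
    obtain e' \<omega>' where f': "frame J {1..4} e' \<omega>' UNIV" "e' 2 = y" "e' 3 = W" "e' 4 = Z"
      by (rule adapted_frame_exists[OF Z W y(1,3)])
    interpret b: adapted_frame br J "e' 1" "e' 2" "e' 3" "e' 4" "\<omega>' 1" "\<omega>' 2" "\<omega>' 3" "\<omega>' 4"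
      by (rule adapted_frame_of_frame) (use f' Z W y in simp_all)
    show ?thesis using b.Je4_in_C3_if_Je2_in_C3 f' y by simp
  qed (use f in simp)
  then have "normalised_frame br J (e 1) (e 2) (e 3) (e 4) (\<omega> 1) (\<omega> 2) (\<omega> 3) (\<omega> 4)"
    using f(4) by unfold_locales simp
  then show ?thesis using f(1) that by blast
qed

lemma structure_equations_exist:
  "\<exists>\<omega> A D E F L M N s. basis10 J \<omega> \<and> structure_equations br \<omega> A D E F L M N s"
proof -
  obtain e \<omega> where f: "frame J {1..4} e \<omega> UNIV"
    "normalised_frame br J (e 1) (e 2) (e 3) (e 4) (\<omega> 1) (\<omega> 2) (\<omega> 3) (\<omega> 4)"
    by (rule normalised_frame_exists)
  interpret n: normalised_frame br J "e 1" "e 2" "e 3" "e 4" "\<omega> 1" "\<omega> 2" "\<omega> 3" "\<omega> 4"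
    by (rule f(2))
  obtain A D E F L M N s where "structure_equations br \<omega> A D E F L M N s"
    using n.structure_constants unfolding structure_equations_def Let_def by metis
  then show ?thesis using frame_basis10[OF f(1)] by blast
qed

end

theorem proposition4p13:
  fixes br :: "'g::real_vector \<Rightarrow> 'g \<Rightarrow> 'g" and J :: "'g \<Rightarrow> 'g"
  assumes "lie_algebra br"
    and "nilpotent_lie br"
    and "dim (UNIV :: 'g set) = 8"
    and "complex_structure br J"
    and "strongly_non_nilpotent br J"
    and "dim (ascending_central br 1) = 1"
    and "dim (ascending_central br 2) = 4"
  shows "(\<exists>\<omega> A D E F L M N s.
            basis10 J \<omega> \<and> structure_equations br \<omega> A D E F L M N s \<and>
            (\<forall>k\<in>{1..4}. \<forall>X Y Z. d2 br (d1 br (\<omega> k)) X Y Z = 0)) \<and>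
         (\<forall>\<omega> A D E F L M N s.
            basis10 J \<omega> \<and> structure_equations br \<omega> A D E F L M N s \<longrightarrow>
            (ascending_type br = [1, 4, 8] \<longrightarrow> (Re A, Re L) = (0, 0)) \<and>
            (ascending_type br = [1, 4, 6, 8] \<longrightarrow> (Re A, Re L) \<noteq> (0, 0)))"
proof -
  interpret snn_type_1_4 br J
    using assms by unfold_locales
  have "linear (\<omega> k)" if "basis10 J \<omega>" "k \<in> {1..4}" for \<omega> and k :: nat
    using that unfolding basis10_def by (metis cform.span_base forms10_linear imageI)
  then have "\<exists>\<omega> A D E F L M N s.
      basis10 J \<omega> \<and> structure_equations br \<omega> A D E F L M N s \<and>
      (\<forall>k\<in>{1..4}. \<forall>X Y Z. d2 br (d1 br (\<omega> k)) X Y Z = 0)"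
    using structure_equations_exist d2_d1_eq_0 by meson
  then show ?thesis
    using C3_eq_UNIV_iff_real_parts_vanish C3_eq_UNIV_from_type by blast
qed

end
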